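(* Fix $\delta>0$, $\alpha>0$, $C_0\ge0$ and $\gamma\ge0$. Then there exists a pair of distinct 1-subgaussian distributions $g,g'$ on $\mathbb R$ such that, for all large enough $n,p$ with $n\le p^{1-\delta}$ and every design $\mathbf X\in\mathbb R^{n\times p}$ (and noise level $\sigma>0$) satisfying $$\max_{j\in[p]}\|\tilde{\mathbf X}\mathbf e_j\|\le C_0\Big(\frac np\Big)^\alpha(\log p)^\gamma,\qquad\text{where }\tilde{\mathbf X}=(\mathbf X\mathbf X^\top+\sigma^2\mathbf I_n)^{-1/2}\mathbf X,$$ we have $$\mathrm{TV}\big(P_g(\mathbf y),P_{g'}(\mathbf y)\big)\le0.1 .$$
   Context: For a probability distribution $g$ on $\mathbb R$, $P_g(\mathbf y)$ denotes the law (conditional on the fixed design $\mathbf X$) of $\mathbf y=\mathbf X\boldsymbol\beta+\boldsymbol\varepsilon\in\mathbb R^n$, where $\boldsymbol\beta=(\beta_1,\dots,\beta_p)$ has i.i.d. coordinates drawn from $g$ and $\boldsymbol\varepsilon\sim N(0,\sigma^2\mathbf I_n)$ is independent of $\boldsymbol\beta$. $\mathrm{TV}$ is the total variation distance, $\|\cdot\|$ the Euclidean norm, $\mathbf e_j$ the $j$-th standard basis vector of $\mathbb R^p$. A distribution $g$ is $M$-subgaussian if $(\mathbb E_{\beta\sim g}|\beta-\mathbb E_{\beta\sim g}[\beta]|^q)^{1/q}\le M\sqrt q$ for all positive integers $q$. *)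

theory Defs
  imports
    "HOL-Probability.Probability"
    "Jordan_Normal_Form.Spectral_Radius"
begin

unbundle no vec_syntax and no inner_syntax

definition positive_definite_mat :: "real mat \<Rightarrow> bool" where
  "positive_definite_mat A \<longleftrightarrow>
     square_mat A \<and> A\<^sup>T = A \<and>
     (\<forall>v \<in> carrier_vec (dim_row A). v \<noteq> 0\<^sub>v (dim_row A) \<longrightarrow> 0 < v \<bullet> (A *\<^sub>v v))"

(* The power -1/2 of a positive definite matrix: the unique positive definite S with S^2 the
   inverse of A.  Existence and uniqueness are proved below (inv_sqrt_mat). *)
definition inv_sqrt_mat :: "real mat \<Rightarrow> real mat" where
  "inv_sqrt_mat A =
     (THE S. S \<in> carrier_mat (dim_row A) (dim_row A) \<and> positive_definite_mat S \<and>
             inverts_mat A (S * S))"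

definition whitened_design :: "real mat \<Rightarrow> real \<Rightarrow> real mat" where
  "whitened_design X \<sigma> =
     inv_sqrt_mat (X * X\<^sup>T + \<sigma>\<^sup>2 \<cdot>\<^sub>m 1\<^sub>m (dim_row X)) * X"

definition euclidean_norm_vec :: "real vec \<Rightarrow> real" where
  "euclidean_norm_vec v = sqrt (v \<bullet> v)"

(* The law of y = X \<beta> + \<epsilon>.  Vectors of R^p and R^n are extensional functions on {..<p} and
   {..<n}; N(0, \<sigma>^2 I_n) is the n-fold product of N(0, \<sigma>^2), the second argument of
   normal_density being the standard deviation. *)
definition response_law :: "real measure \<Rightarrow> real mat \<Rightarrow> real \<Rightarrow> (nat \<Rightarrow> real) measure" where
  "response_law g X \<sigma> =
     distr ((\<Pi>\<^sub>M j\<in>{..<dim_col X}. g) \<Otimes>\<^sub>M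
            (\<Pi>\<^sub>M i\<in>{..<dim_row X}. density lborel (normal_density 0 \<sigma>)))
       (\<Pi>\<^sub>M i\<in>{..<dim_row X}. borel)
       (\<lambda>(\<beta>, \<epsilon>). \<lambda>i\<in>{..<dim_row X}. (\<Sum>j<dim_col X. X $$ (i, j) * \<beta> j) + \<epsilon> i)"

(* For probability measures P and Q on the same sigma-algebra. *)
definition total_variation :: "'a measure \<Rightarrow> 'a measure \<Rightarrow> real" where
  "total_variation P Q = (SUP A\<in>sets P. \<bar>measure P A - measure Q A\<bar>)"

(* The moments are required to be finite explicitly, because the Bochner integral of a
   non-integrable function is 0. *)
definition subgaussian :: "real \<Rightarrow> real measure \<Rightarrow> bool" where
  "subgaussian M g \<longleftrightarrow>
     integrable g (\<lambda>b. b) \<and>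
     (\<forall>q::nat. q \<ge> 1 \<longrightarrow>
        integrable g (\<lambda>b. \<bar>b - (\<integral>b. b \<partial>g)\<bar> ^ q) \<and>
        root q (\<integral>b. \<bar>b - (\<integral>b. b \<partial>g)\<bar> ^ q \<partial>g) \<le> M * sqrt (real q))"

lemma sym_scalar:
  fixes A :: "real mat"
  assumes "A \<in> carrier_mat n n" "A\<^sup>T = A" "x \<in> carrier_vec n" "y \<in> carrier_vec n"
  shows "x \<bullet> (A *\<^sub>v y) = (A *\<^sub>v x) \<bullet> y"
  by (metis assms transpose_vec_mult_scalar mult_mat_vec_carrier comm_scalar_prod)

lemma scalar_self_pos:
  fixes v :: "real vec"
  assumes "v \<in> carrier_vec n" "v \<noteq> 0\<^sub>v n"
  shows "0 < v \<bullet> v"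
proof -
  obtain i where i: "i < n" "v $ i \<noteq> 0" using assms by (metis carrier_vecD eq_vecI index_zero_vec(1) index_zero_vec(2))
  show ?thesis unfolding scalar_prod_def
    by (rule sum_pos2[of _ i]) (use i assms in \<open>auto simp: zero_less_mult_iff linorder_neq_iff\<close>)
qed

lemma sym_eigenvector:
  fixes A :: "real mat"
  assumes A: "A \<in> carrier_mat n n" and sym: "A\<^sup>T = A" and n: "n > 0"
  obtains v e where "v \<in> carrier_vec n" "v \<bullet> v = 1" "A *\<^sub>v v = e \<cdot>\<^sub>v v"
proof -
  let ?C = "map_mat complex_of_real A"
  have C: "?C \<in> carrier_mat n n" using A by auto
  obtain k where "k \<in> spectrum ?C" using spectrum_non_empty[OF C n] by auto
  then obtain w where w: "w \<in> carrier_vec n" "w \<noteq> 0\<^sub>v n" "?C *\<^sub>v w = k \<cdot>\<^sub>v w"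
    using C unfolding spectrum_def eigenvalue_def eigenvector_def by auto
  define x where "x = map_vec Re w"
  define y where "y = map_vec Im w"
  have x: "x \<in> carrier_vec n" and y: "y \<in> carrier_vec n" using w by (auto simp: x_def y_def)
  have comp: "(\<Sum>j<n. complex_of_real (A $$ (i,j)) * w $ j) = k * w $ i" if "i < n" for i
    using arg_cong[OF w(3), of "\<lambda>v. v $ i"] that w(1) A
    by (auto simp: scalar_prod_def atLeast0LessThan)
  have Ax: "A *\<^sub>v x = Re k \<cdot>\<^sub>v x - Im k \<cdot>\<^sub>v y"
  proof (rule eq_vecI)
    fix i assume "i < dim_vec (Re k \<cdot>\<^sub>v x - Im k \<cdot>\<^sub>v y)"
    then have i: "i < n" using x y by auto
    show "(A *\<^sub>v x) $ i = (Re k \<cdot>\<^sub>v x - Im k \<cdot>\<^sub>v y) $ i"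
      using arg_cong[OF comp[OF i], of Re] i x y w A
      by (auto simp: scalar_prod_def atLeast0LessThan x_def y_def)
  qed (use A x y in auto)
  have Ay: "A *\<^sub>v y = Im k \<cdot>\<^sub>v x + Re k \<cdot>\<^sub>v y"
  proof (rule eq_vecI)
    fix i assume "i < dim_vec (Im k \<cdot>\<^sub>v x + Re k \<cdot>\<^sub>v y)"
    then have i: "i < n" using x y by auto
    show "(A *\<^sub>v y) $ i = (Im k \<cdot>\<^sub>v x + Re k \<cdot>\<^sub>v y) $ i"
      using arg_cong[OF comp[OF i], of Im] i x y w A
      by (auto simp: scalar_prod_def atLeast0LessThan x_def y_def)
  qed (use A x y in auto)
  have xy: "x \<noteq> 0\<^sub>v n \<or> y \<noteq> 0\<^sub>v n"
  proof (rule ccontr)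
    assume "\<not> ?thesis"
    then have "x = 0\<^sub>v n" "y = 0\<^sub>v n" by auto
    then have "x $ i = 0" "y $ i = 0" if "i < n" for i using that by auto
    then have "w $ i = 0" if "i < n" for i
      using that w(1) unfolding x_def y_def by (metis carrier_vecD complex_eq_iff index_map_vec(1) zero_complex.sel)
    then show False using w by (metis carrier_vecD eq_vecI index_zero_vec(1) index_zero_vec(2))
  qed
  have "y \<bullet> (A *\<^sub>v x) = (A *\<^sub>v y) \<bullet> x" using sym_scalar[OF A sym y x] .
  then have "Im k * (x \<bullet> x + y \<bullet> y) = 0"
    unfolding Ax Ay using x y
    by (simp add: scalar_prod_minus_distrib[of _ n] add_scalar_prod_distrib[of _ n] algebra_simps)
  moreover have "x \<bullet> x + y \<bullet> y > 0"
  proof -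
    have "x \<bullet> x \<ge> 0" "y \<bullet> y \<ge> 0" by (auto simp: scalar_prod_def intro: sum_nonneg)
    then show ?thesis using xy scalar_self_pos[OF x] scalar_self_pos[OF y] by linarith
  qed
  ultimately have Im: "Im k = 0" by auto
  obtain z where z: "z \<in> carrier_vec n" "z \<noteq> 0\<^sub>v n" "A *\<^sub>v z = Re k \<cdot>\<^sub>v z"
  proof -
    have "A *\<^sub>v x = Re k \<cdot>\<^sub>v x"
      unfolding Ax Im by (rule eq_vecI) (use x y in auto)
    moreover have "A *\<^sub>v y = Re k \<cdot>\<^sub>v y"
      unfolding Ay Im by (rule eq_vecI) (use x y in auto)
    ultimately show thesis using that xy x y by blast
  qed
  let ?s = "1 / sqrt (z \<bullet> z)"
  have pos: "z \<bullet> z > 0" using scalar_self_pos z by blast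
  show thesis
  proof (rule that[of "?s \<cdot>\<^sub>v z" "Re k"])
    show "(?s \<cdot>\<^sub>v z) \<bullet> (?s \<cdot>\<^sub>v z) = 1"
      using z(1) pos by (simp add: field_simps)
    show "A *\<^sub>v (?s \<cdot>\<^sub>v z) = Re k \<cdot>\<^sub>v (?s \<cdot>\<^sub>v z)"
      using z A by (simp add: mult_mat_vec smult_smult_assoc mult.commute)
  qed (use z in auto)
qed

lemma householder_reflection:
  fixes v :: "real vec"
  assumes v: "v \<in> carrier_vec n" "v \<bullet> v = 1" and n: "n > 0"
  obtains Q where "Q \<in> carrier_mat n n" "Q\<^sup>T = Q" "Q * Q = 1\<^sub>m n" "col Q 0 = v"
proof -
  define u where "u i = v $ i - (if i = 0 then 1 else 0)" for i
  define t where "t = (\<Sum>i<n. u i * u i)"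
  define c where "c = 2 / t"
  define Q where "Q = mat n n (\<lambda>(i, j). (if i = j then 1 else 0) - c * u i * u j)"
  have vv: "(\<Sum>i<n. v $ i * v $ i) = 1"
    using v by (simp add: scalar_prod_def atLeast0LessThan)
  have "t = (\<Sum>i<n. v $ i * v $ i - 2 * (if i = 0 then v $ 0 else 0) + (if i = 0 then 1 else 0))"
    unfolding t_def u_def by (intro sum.cong) (auto simp: algebra_simps)
  also have "\<dots> = 2 * (1 - v $ 0)"
    using vv n by (simp add: sum.distrib sum_subtractf sum_distrib_left[symmetric] sum.delta)
  finally have t: "t = 2 * (1 - v $ 0)" .
  have cct: "c * c * t = 2 * c" by (simp add: c_def)
  have t0: "u i = 0" if "t = 0" "i < n" for i
    using that sum_nonneg_eq_0_iff[of "{..<n}" "\<lambda>i. u i * u i"] by (auto simp: t_def)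
  have "Q * Q = 1\<^sub>m n"
  proof (rule eq_matI)
    fix i j assume "i < dim_row (1\<^sub>m n :: real mat)" "j < dim_col (1\<^sub>m n :: real mat)"
    then have ij: "i < n" "j < n" by auto
    have "(Q * Q) $$ (i, j) =
        (\<Sum>k<n. ((if i = k then 1 else 0) - c * u i * u k) * ((if k = j then 1 else 0) - c * u k * u j))"
      using ij by (simp add: Q_def scalar_prod_def atLeast0LessThan)
    also have "\<dots> = (\<Sum>k<n. (if k = i then (if i = j then 1 else 0) - c * u i * u j else 0)
        - (if k = j then c * u i * u j else 0) + c * c * u i * u j * (u k * u k))"
      by (intro sum.cong) (auto simp: algebra_simps)
    also have "\<dots> = (if i = j then 1 else 0) - c * u i * u j - c * u i * u j + c * c * u i * u j * t"
      using ij by (simp add: sum.distrib sum_subtractf sum_distrib_left[symmetric] sum.delta t_def)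
    also have "\<dots> = (if i = j then 1 else 0) - 2 * c * u i * u j + (c * c * t) * u i * u j"
      by (simp add: algebra_simps)
    also have "\<dots> = (if i = j then 1 else 0)" unfolding cct by simp
    finally show "(Q * Q) $$ (i, j) = 1\<^sub>m n $$ (i, j)" using ij by simp
  qed (auto simp: Q_def)
  moreover have "col Q 0 = v"
  proof (rule eq_vecI)
    fix i assume "i < dim_vec v"
    then have i: "i < n" using v by auto
    show "col Q 0 $ i = v $ i"
    proof (cases "t = 0")
      case True
      then show ?thesis using t0[OF True i] i n by (auto simp: Q_def u_def c_def)
    next
      case False
      have "c * u 0 = - 1" using False t n by (simp add: c_def u_def field_simps)
      then have "c * u i * u 0 = - u i" by (metis mult.assoc mult.commute mult_minus1)
      then show ?thesis using i n by (auto simp: Q_def u_def)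
    qed
  qed (use v in \<open>auto simp: Q_def\<close>)
  ultimately show thesis by (intro that[of Q]) (auto simp: Q_def)
qed

lemma positive_definite_mat_iff:
  assumes "A \<in> carrier_mat n n"
  shows "positive_definite_mat A \<longleftrightarrow>
    A\<^sup>T = A \<and> (\<forall>v \<in> carrier_vec n. v \<noteq> 0\<^sub>v n \<longrightarrow> 0 < v \<bullet> (A *\<^sub>v v))"
  using assms by (auto simp: positive_definite_mat_def)

lemma positive_definite_conj:
  assumes A: "A \<in> carrier_mat n n" "positive_definite_mat A"
    and Q: "Q \<in> carrier_mat n n" "Q\<^sup>T = Q" "Q * Q = 1\<^sub>m n"
  shows "positive_definite_mat (Q * A * Q)"
proof -
  have AT: "A\<^sup>T = A" using A by (simp add: positive_definite_mat_def)
  have "(Q * A * Q)\<^sup>T = Q\<^sup>T * (Q * A)\<^sup>T"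
    using A Q by (intro transpose_mult[of _ n n _ n]) auto
  also have "(Q * A)\<^sup>T = A\<^sup>T * Q\<^sup>T"
    using A Q by (intro transpose_mult[of _ n n _ n]) auto
  finally have "(Q * A * Q)\<^sup>T = Q\<^sup>T * (A\<^sup>T * Q\<^sup>T)" .
  then have T: "(Q * A * Q)\<^sup>T = Q * A * Q"
    using A Q AT by (simp add: assoc_mult_mat[of _ n n])
  have "0 < v \<bullet> (Q * A * Q *\<^sub>v v)" if v: "v \<in> carrier_vec n" "v \<noteq> 0\<^sub>v n" for v
  proof -
    have "Q *\<^sub>v (Q *\<^sub>v v) = v" using Q v by (simp add: assoc_mult_mat_vec[symmetric, of _ n n _ n])
    moreover have "Q *\<^sub>v 0\<^sub>v n = 0\<^sub>v n" using Q by (intro eq_vecI) auto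
    ultimately have "Q *\<^sub>v v \<noteq> 0\<^sub>v n" using v by auto
    then have "0 < (Q *\<^sub>v v) \<bullet> (A *\<^sub>v (Q *\<^sub>v v))"
      using A Q v by (simp add: positive_definite_mat_def)
    also have "\<dots> = v \<bullet> (Q *\<^sub>v (A *\<^sub>v (Q *\<^sub>v v)))"
      using A Q v sym_scalar[OF Q(1,2) v(1), of "A *\<^sub>v (Q *\<^sub>v v)"] by simp
    also have "Q *\<^sub>v (A *\<^sub>v (Q *\<^sub>v v)) = (Q * A) *\<^sub>v (Q *\<^sub>v v)"
      using A Q v by (intro assoc_mult_mat_vec[symmetric, of _ n n _ n]) auto
    also have "\<dots> = Q * A * Q *\<^sub>v v"
      using A Q v by (intro assoc_mult_mat_vec[symmetric, of _ n n _ n]) auto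
    finally show ?thesis .
  qed
  then show ?thesis using T A Q by (simp add: positive_definite_mat_iff[of _ n])
qed

lemma inv_sqrt_exists:
  assumes "A \<in> carrier_mat n n" "positive_definite_mat A"
  shows "\<exists>S \<in> carrier_mat n n. positive_definite_mat S \<and> A * (S * S) = 1\<^sub>m n"
  using assms
proof (induction n arbitrary: A)
  case 0
  then show ?case by (intro bexI[of _ "1\<^sub>m 0"]) (auto simp: positive_definite_mat_def)
next
  case (Suc n)
  note A = Suc.prems(1)
  have AT: "A\<^sup>T = A" using Suc.prems by (simp add: positive_definite_mat_def)
  obtain v e where v: "v \<in> carrier_vec (Suc n)" "v \<bullet> v = 1" "A *\<^sub>v v = e \<cdot>\<^sub>v v"
    using sym_eigenvector[OF A AT] by blast
  obtain Q where Q: "Q \<in> carrier_mat (Suc n) (Suc n)" "Q\<^sup>T = Q" "Q * Q = 1\<^sub>m (Suc n)" "col Q 0 = v"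
    using householder_reflection[OF v(1,2)] by blast
  have "v \<noteq> 0\<^sub>v (Suc n)" using v by auto
  then have "0 < v \<bullet> (A *\<^sub>v v)" using Suc.prems v by (auto simp: positive_definite_mat_def)
  then have e: "e > 0" using v by simp
  define B where "B = Q * A * Q"
  have B: "B \<in> carrier_mat (Suc n) (Suc n)" using A Q by (simp add: B_def)
  have pdB: "positive_definite_mat B"
    unfolding B_def by (rule positive_definite_conj[OF Suc.prems Q(1-3)])
  then have BT: "B\<^sup>T = B" by (simp add: positive_definite_mat_def)
  have "col (Q * Q) 0 = Q *\<^sub>v col Q 0"
    using Q(1) by (intro col_mult2[of _ "Suc n" "Suc n" _ "Suc n"]) auto
  then have "Q *\<^sub>v v = col (Q * Q) 0" using Q(4) by simp
  then have Qv: "Q *\<^sub>v v = unit_vec (Suc n) 0" using Q(3) by simp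
  have "col B 0 = Q * A *\<^sub>v col Q 0"
    unfolding B_def using A Q by (intro col_mult2[of _ "Suc n" "Suc n" _ "Suc n"]) auto
  also have "\<dots> = e \<cdot>\<^sub>v unit_vec (Suc n) 0"
    using A Q v Qv by (simp add: mult_mat_vec)
  finally have colB: "col B 0 = e \<cdot>\<^sub>v unit_vec (Suc n) 0" .
  have B0: "B $$ (i, 0) = (if i = 0 then e else 0)" if "i < Suc n" for i
    using arg_cong[OF colB, of "\<lambda>w. w $ i"] that B by (auto simp: unit_vec_def)
  have B0': "B $$ (0, i) = (if i = 0 then e else 0)" if "i < Suc n" for i
    using B0[OF that] arg_cong[OF BT, of "\<lambda>M. M $$ (0, i)"] that B by auto
  define C where "C = mat n n (\<lambda>(i, j). B $$ (Suc i, Suc j))"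
  define blk where "blk a M = four_block_mat (mat 1 1 (\<lambda>_. a)) (0\<^sub>m 1 n) (0\<^sub>m n 1) M" for a :: real and M
  have C: "C \<in> carrier_mat n n" by (simp add: C_def)
  have blk: "blk a M \<in> carrier_mat (Suc n) (Suc n)" if "M \<in> carrier_mat n n" for a M
    using that unfolding blk_def by (intro carrier_matI) auto
  have Bblk: "B = blk e C"
    by (rule eq_matI) (use B B0 B0' in \<open>auto simp: blk_def C_def less_Suc_eq_0_disj\<close>)
  have blk_mult: "blk a M * blk b N = blk (a * b) (M * N)"
    if "M \<in> carrier_mat n n" "N \<in> carrier_mat n n" for a b M N
    unfolding blk_def using that
    by (subst mult_four_block_mat[of _ 1 1 _ n _ n _ _ 1 _ n])
       (auto intro!: arg_cong[of _ _ "\<lambda>X. four_block_mat X _ _ _"] eq_matI simp: scalar_prod_def)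
  have blk_T: "(blk a M)\<^sup>T = blk a (M\<^sup>T)" if "M \<in> carrier_mat n n" for a M
    by (rule eq_matI) (use that in \<open>auto simp: blk_def less_Suc_eq_0_disj\<close>)
  have blk_form: "w \<bullet> (blk a M *\<^sub>v w) = a * (w $ 0)\<^sup>2 + vec n (\<lambda>i. w $ Suc i) \<bullet> (M *\<^sub>v vec n (\<lambda>i. w $ Suc i))"
    if "M \<in> carrier_mat n n" "w \<in> carrier_vec (Suc n)" for a M w
    using that
    by (simp add: scalar_prod_def blk_def atLeast0LessThan sum.lessThan_Suc_shift power2_eq_square del: sum.lessThan_Suc)
  have "positive_definite_mat C"
  proof -
    have "C\<^sup>T = C"
      by (rule eq_matI) (use BT B in \<open>auto simp: C_def, metis (no_types, lifting) Suc_less_eq carrier_matD index_transpose_mat(1)\<close>)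
    moreover have "0 < w \<bullet> (C *\<^sub>v w)" if w: "w \<in> carrier_vec n" "w \<noteq> 0\<^sub>v n" for w
    proof -
      let ?w = "vec (Suc n) (\<lambda>i. if i = 0 then 0 else w $ (i - 1))"
      have eq: "vec n (\<lambda>i. ?w $ Suc i) = w" by (rule eq_vecI) (use w in auto)
      have "?w \<noteq> 0\<^sub>v (Suc n)"
      proof
        assume *: "?w = 0\<^sub>v (Suc n)"
        have "vec n (\<lambda>i. ?w $ Suc i) = 0\<^sub>v n" unfolding * by (rule eq_vecI) auto
        with eq w show False by simp
      qed
      then have "0 < ?w \<bullet> (B *\<^sub>v ?w)" using pdB B by (auto simp: positive_definite_mat_iff)
      then show ?thesis unfolding Bblk blk_form[OF C vec_carrier] eq by simp
    qed
    ultimately show ?thesis using C by (simp add: positive_definite_mat_iff)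
  qed
  from Suc.IH[OF C this] obtain T
    where T: "T \<in> carrier_mat n n" "positive_definite_mat T" "C * (T * T) = 1\<^sub>m n" by blast
  define R where "R = blk (1 / sqrt e) T"
  have R: "R \<in> carrier_mat (Suc n) (Suc n)" using blk T by (simp add: R_def)
  have pdR: "positive_definite_mat R"
  proof -
    have "0 < w \<bullet> (R *\<^sub>v w)" if w: "w \<in> carrier_vec (Suc n)" "w \<noteq> 0\<^sub>v (Suc n)" for w
    proof (cases "w $ 0 = 0")
      case True
      have "vec n (\<lambda>i. w $ Suc i) \<noteq> 0\<^sub>v n"
      proof
        assume *: "vec n (\<lambda>i. w $ Suc i) = 0\<^sub>v n"
        have "w $ Suc j = 0" if "j < n" for j
          using arg_cong[OF *, of "\<lambda>x. x $ j"] that by simp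
        then have "w = 0\<^sub>v (Suc n)"
          by (intro eq_vecI) (use w True in \<open>auto simp: less_Suc_eq_0_disj\<close>)
        with w show False by simp
      qed
      then show ?thesis unfolding R_def blk_form[OF T(1) w(1)]
        using T True by (simp add: positive_definite_mat_def)
    next
      case False
      have "0 \<le> vec n (\<lambda>i. w $ Suc i) \<bullet> (T *\<^sub>v vec n (\<lambda>i. w $ Suc i))"
        using T(1,2) by (cases "vec n (\<lambda>i. w $ Suc i) = 0\<^sub>v n")
          (auto simp: positive_definite_mat_def less_imp_le)
      then show ?thesis unfolding R_def blk_form[OF T(1) w(1)]
        using e False by (simp add: add_pos_nonneg)
    qed
    moreover have "R\<^sup>T = R" using T by (simp add: R_def blk_T positive_definite_mat_def)
    ultimately show ?thesis using R by (simp add: positive_definite_mat_iff)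
  qed
  have "B * (R * R) = blk 1 (1\<^sub>m n)"
    unfolding Bblk R_def using C T e by (simp add: blk_mult)
  also have "\<dots> = 1\<^sub>m (Suc n)"
    by (rule eq_matI) (auto simp: blk_def less_Suc_eq_0_disj split: if_splits)
  finally have BRR: "B * (R * R) = 1\<^sub>m (Suc n)" .
  define S where "S = Q * R * Q"
  note assoc = assoc_mult_mat[of _ "Suc n" "Suc n" _ "Suc n" _ "Suc n"]
  have cancel: "Q * (Q * M) = M" if "M \<in> carrier_mat (Suc n) (Suc n)" for M
    using that Q by (simp add: assoc[symmetric])
  have "A * (S * S) = Q * (B * (R * R)) * Q"
    unfolding S_def B_def using A Q R by (simp add: assoc cancel)
  also have "\<dots> = 1\<^sub>m (Suc n)" unfolding BRR using Q by simp
  finally have "A * (S * S) = 1\<^sub>m (Suc n)" .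
  moreover have "positive_definite_mat S"
    unfolding S_def by (rule positive_definite_conj[OF R pdR Q(1-3)])
  moreover have "S \<in> carrier_mat (Suc n) (Suc n)" using Q R by (simp add: S_def)
  ultimately show ?case by blast
qed

lemma sqrt_unique:
  assumes S: "S \<in> carrier_mat n n" "positive_definite_mat S"
    and T: "T \<in> carrier_mat n n" "positive_definite_mat T"
    and eq: "S * S = T * T"
  shows "S = T"
proof -
  define D where "D = S - T"
  have D: "D \<in> carrier_mat n n" using S T by (simp add: D_def minus_carrier_mat)
  have sym: "S\<^sup>T = S" "T\<^sup>T = T" using S T by (auto simp: positive_definite_mat_def)
  have DT: "D\<^sup>T = D" using S T sym by (simp add: D_def transpose_minus)
  have SD: "S * D + D * T = 0\<^sub>m n n"
  proof -
    have "S * D = S * S - S * T" "D * T = S * T - T * T"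
      using S T by (auto simp: D_def mult_minus_distrib_mat[of _ n n] minus_mult_distrib_mat[of _ n n])
    then show ?thesis using S T unfolding eq by (intro eq_matI) auto
  qed
  have Drow: "row D i = col D i" if "i < n" for i
    using that D DT by (metis carrier_matD(2) col_transpose carrier_matD(1))
  define f where "f M = (\<Sum>i<n. M $$ (i, i))" for M :: "real mat"
  have tr_comm: "f (M * N) = f (N * M)" if "M \<in> carrier_mat n n" "N \<in> carrier_mat n n" for M N
    using that unfolding f_def
    by (simp add: scalar_prod_def atLeast0LessThan mult.commute) (rule sum.swap)
  have quad: "f (D * (M * D)) = (\<Sum>i<n. col D i \<bullet> (M *\<^sub>v col D i))" if "M \<in> carrier_mat n n" for M
    unfolding f_def using that D
    by (intro sum.cong) (auto simp: Drow intro!: arg_cong[of _ _ "\<lambda>w. _ \<bullet> w"] eq_vecI)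
  have nonneg: "0 \<le> col D i \<bullet> (M *\<^sub>v col D i)"
    if "M \<in> carrier_mat n n" "positive_definite_mat M" "i < n" for M i
    using that D by (cases "col D i = 0\<^sub>v n") (auto simp: positive_definite_mat_def less_imp_le)
  have "f (D * (S * D)) + f (D * (T * D)) = f (D * (S * D)) + f (D * (D * T))"
    using tr_comm[of "D * T" D] D T by (simp add: assoc_mult_mat[of _ n n])
  also have "\<dots> = f (D * (S * D) + D * (D * T))" using S T D by (simp add: f_def sum.distrib)
  also have "\<dots> = f (D * (S * D + D * T))"
    using S T D by (subst mult_add_distrib_mat[of D n n _ n]) auto
  also have "\<dots> = 0" unfolding SD using D by (simp add: f_def)
  finally have sum0: "f (D * (S * D)) + f (D * (T * D)) = 0" .
  have "0 \<le> f (D * (S * D))" "0 \<le> f (D * (T * D))"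
    unfolding quad[OF S(1)] quad[OF T(1)] using nonneg S T by (auto intro!: sum_nonneg)
  with sum0 have "(\<Sum>i<n. col D i \<bullet> (S *\<^sub>v col D i)) = 0" unfolding quad[OF S(1)] by linarith
  then have z: "col D i \<bullet> (S *\<^sub>v col D i) = 0" if "i < n" for i
    using that nonneg[OF S] by (subst (asm) sum_nonneg_eq_0_iff) auto
  have colD: "col D i = 0\<^sub>v n" if "i < n" for i
  proof (rule ccontr)
    assume "col D i \<noteq> 0\<^sub>v n"
    then have "0 < col D i \<bullet> (S *\<^sub>v col D i)"
      using S D that by (simp add: positive_definite_mat_def)
    then show False using z[OF that] by simp
  qed
  show ?thesis
  proof (rule eq_matI)
    fix i j assume "i < dim_row T" "j < dim_col T"
    then have ij: "i < n" "j < n" using T by auto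
    have "D $$ (i, j) = 0" using arg_cong[OF colD[OF ij(2)], of "\<lambda>w. w $ i"] ij D by auto
    then show "S $$ (i, j) = T $$ (i, j)" using ij S T by (simp add: D_def)
  qed (use S T in auto)
qed

lemma inv_sqrt_unique:
  assumes A: "A \<in> carrier_mat n n" "positive_definite_mat A"
    and S: "S \<in> carrier_mat n n" "positive_definite_mat S" "A * (S * S) = 1\<^sub>m n"
    and T: "T \<in> carrier_mat n n" "positive_definite_mat T" "A * (T * T) = 1\<^sub>m n"
  shows "S = T"
proof (rule sqrt_unique[OF S(1,2) T(1,2)])
  have "S * S = (T * T * A) * (S * S)"
    using mat_mult_left_right_inverse[OF A(1) _ T(3)] S T by simp
  also have "\<dots> = T * T * (A * (S * S))"
    using A S T by (intro assoc_mult_mat[of _ n n _ n _ n]) auto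
  also have "\<dots> = T * T" using S T by simp
  finally show "S * S = T * T" .
qed

lemma inv_sqrt_mat:
  assumes "A \<in> carrier_mat n n" "positive_definite_mat A"
  shows "inv_sqrt_mat A \<in> carrier_mat n n" "positive_definite_mat (inv_sqrt_mat A)"
    "A * (inv_sqrt_mat A * inv_sqrt_mat A) = 1\<^sub>m n"
proof -
  let ?P = "\<lambda>S. S \<in> carrier_mat (dim_row A) (dim_row A) \<and> positive_definite_mat S \<and>
    inverts_mat A (S * S)"
  have dim: "dim_row A = n" using assms by simp
  have "\<exists>!S. ?P S"
    unfolding inverts_mat_def dim
    using inv_sqrt_exists[OF assms] inv_sqrt_unique[OF assms] by blast
  then have "?P (inv_sqrt_mat A)" unfolding inv_sqrt_mat_def by (rule theI')
  then show "inv_sqrt_mat A \<in> carrier_mat n n" "positive_definite_mat (inv_sqrt_mat A)"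
    "A * (inv_sqrt_mat A * inv_sqrt_mat A) = 1\<^sub>m n"
    unfolding inverts_mat_def dim by auto
qed

lemma positive_definite_gram_plus_noise:
  assumes X: "X \<in> carrier_mat n p" and \<sigma>: "\<sigma> > 0"
  shows "positive_definite_mat (X * X\<^sup>T + \<sigma>\<^sup>2 \<cdot>\<^sub>m 1\<^sub>m n)"
proof -
  let ?A = "X * X\<^sup>T + \<sigma>\<^sup>2 \<cdot>\<^sub>m 1\<^sub>m n"
  have A: "?A \<in> carrier_mat n n" using X by simp
  have "?A\<^sup>T = ?A"
    by (rule eq_matI) (use X in \<open>auto simp: comm_scalar_prod[of _ p]\<close>)
  moreover have "0 < v \<bullet> (?A *\<^sub>v v)" if v: "v \<in> carrier_vec n" "v \<noteq> 0\<^sub>v n" for v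
  proof -
    have "?A *\<^sub>v v = (X * X\<^sup>T) *\<^sub>v v + (\<sigma>\<^sup>2 \<cdot>\<^sub>m 1\<^sub>m n) *\<^sub>v v"
      using X v by (intro add_mult_distrib_mat_vec[of _ n n]) auto
    also have "(X * X\<^sup>T) *\<^sub>v v = X *\<^sub>v (X\<^sup>T *\<^sub>v v)"
      using X v by (intro assoc_mult_mat_vec[of _ n p _ n]) auto
    also have "(\<sigma>\<^sup>2 \<cdot>\<^sub>m 1\<^sub>m n) *\<^sub>v v = \<sigma>\<^sup>2 \<cdot>\<^sub>v v"
      using v by (intro eq_vecI) (auto simp: smult_scalar_prod_distrib[of _ n])
    finally have "v \<bullet> (?A *\<^sub>v v) = v \<bullet> (X *\<^sub>v (X\<^sup>T *\<^sub>v v)) + \<sigma>\<^sup>2 * (v \<bullet> v)"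
      using X v by (simp add: scalar_prod_add_distrib[of _ n])
    also have "v \<bullet> (X *\<^sub>v (X\<^sup>T *\<^sub>v v)) = (X\<^sup>T *\<^sub>v v) \<bullet> (X\<^sup>T *\<^sub>v v)"
      using X v transpose_vec_mult_scalar[of X n p "X\<^sup>T *\<^sub>v v" v] by simp
    finally have "v \<bullet> (?A *\<^sub>v v) = (X\<^sup>T *\<^sub>v v) \<bullet> (X\<^sup>T *\<^sub>v v) + \<sigma>\<^sup>2 * (v \<bullet> v)" .
    moreover have "0 \<le> (X\<^sup>T *\<^sub>v v) \<bullet> (X\<^sup>T *\<^sub>v v)"
      unfolding scalar_prod_def by (intro sum_nonneg) auto
    moreover have "0 < \<sigma>\<^sup>2 * (v \<bullet> v)" using scalar_self_pos[OF v] \<sigma> by simp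
    ultimately show ?thesis by linarith
  qed
  ultimately show ?thesis using A by (simp add: positive_definite_mat_iff[of _ n])
qed

lemma prob_space_response_law:
  assumes g: "real_distribution g" and \<sigma>: "\<sigma> > 0"
  shows "prob_space (response_law g X \<sigma>)"
proof -
  interpret g: real_distribution g by fact
  let ?N = "density lborel (normal_density 0 \<sigma>)"
  interpret N: prob_space ?N using \<sigma> by (rule prob_space_normal_density)
  interpret G: product_prob_space "\<lambda>_. g" "{..<dim_col X}" by unfold_locales
  interpret E: product_prob_space "\<lambda>_. ?N" "{..<dim_row X}" by unfold_locales
  interpret pair_prob_space "\<Pi>\<^sub>M j\<in>{..<dim_col X}. g" "\<Pi>\<^sub>M i\<in>{..<dim_row X}. ?N"
    by unfold_locales
  have [measurable_cong]: "sets g = sets borel" "sets ?N = sets borel" by simp_all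
  show ?thesis
    unfolding response_law_def by (rule prob_space_distr) measurable
qed

end

theory Submission
  imports Defs "HOL-Real_Asymp.Real_Asymp"
begin

text \<open>
  Both priors are Gaussian mixtures $\sum_{k \le K} w_k N(k/(4K), \tau^2)$ with $\tau = 2/5$, where $w$ is
  the binomial distribution conditioned on even, respectively odd, outcomes. The difference of the
  weights is proportional to $(-1)^k {K \choose k}$, so it annihilates polynomials of degree less than $K$.

  Conditionally on the mixture labels, the response is a Gaussian with covariance
  $\tau^2 X X^T + \sigma^2 I$, shifted by a combination of the columns of $X$. Changing the label
  distribution of one coordinate $j$ moves this Gaussian mixture along the single column $X e_j$. By the
  Cameron-Martin formula the resulting total variation is at most the square root of a chi-square
  distance, which the binomial theorem evaluates as
  $2^{1-K} \sum_k \mu_k (1 - e^{s k})^K$ with $s = O(\|\tilde X e_j\|^2)$; it is $O(\|\tilde X e_j\|^{2K})$. Replacing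
  the $p$ coordinates one at a time costs $O(p \max_j \|\tilde X e_j\|^K)$, which vanishes once $K$
  is large compared with $1/(\delta\alpha)$.
\<close>

section \<open>Gaussian translations as exponential reweightings\<close>

abbreviation gauss :: "real \<Rightarrow> real measure" where
  "gauss s \<equiv> density lborel (\<lambda>x. ennreal (normal_density 0 s x))"

text \<open>For positive \<open>s\<close> this is the Radon-Nikodym derivative of N(v, s^2) with
  respect to N(0, s^2).\<close>

definition gauss_tilt :: "real \<Rightarrow> real \<Rightarrow> real \<Rightarrow> real" where
  "gauss_tilt s v x = exp (v * x / s\<^sup>2 - v\<^sup>2 / (2 * s\<^sup>2))"

lemma gauss_tilt_nonneg [simp]: "0 \<le> gauss_tilt s v x"
  by (simp add: gauss_tilt_def)

lemma gauss_tilt_measurable [measurable]: "gauss_tilt s v \<in> borel_measurable borel"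
  unfolding gauss_tilt_def by measurable

lemma normal_density_tilt:
  assumes "s > 0"
  shows "normal_density v s x = normal_density 0 s x * gauss_tilt s v x"
proof -
  have "- (x - v)\<^sup>2 / (2 * s\<^sup>2) = - (x - 0)\<^sup>2 / (2 * s\<^sup>2) + (v * x / s\<^sup>2 - v\<^sup>2 / (2 * s\<^sup>2))"
    by (simp add: power2_diff diff_divide_distrib add_divide_distrib)
  then show ?thesis unfolding normal_density_def gauss_tilt_def by (simp only: exp_add mult.assoc)
qed

lemma nn_integral_gauss_shift:
  assumes [measurable]: "f \<in> borel_measurable borel"
  shows "(\<integral>\<^sup>+x. f (x + v) \<partial>gauss s) = (\<integral>\<^sup>+x. ennreal (normal_density v s x) * f x \<partial>lborel)"
proof -
  have "(\<integral>\<^sup>+x. f (x + v) \<partial>gauss s) = (\<integral>\<^sup>+x. ennreal (normal_density 0 s x) * f (x + v) \<partial>lborel)"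
    by (subst nn_integral_density) auto
  also have "\<dots> = (\<integral>\<^sup>+x. ennreal (normal_density v s (v + 1 * x)) * f (v + 1 * x) \<partial>lborel)"
    by (simp add: normal_density_def add.commute)
  also have "\<dots> = (\<integral>\<^sup>+x. ennreal (normal_density v s x) * f x \<partial>lborel)"
    by (subst nn_integral_real_affine[of "\<lambda>x. ennreal (normal_density v s x) * f x" 1 v]) auto
  finally show ?thesis .
qed

text \<open>Both sides equal the integral of \<open>f\<close> against
  \<open>normal_density v s\<close>. This is the one-dimensional Cameron-Martin formula; nonnegative
  integrals keep it free of integrability conditions.\<close>

lemma nn_integral_gauss_shift_tilt:
  assumes s: "s > 0" and [measurable]: "f \<in> borel_measurable borel"
  shows "(\<integral>\<^sup>+x. f (x + v) \<partial>gauss s) = (\<integral>\<^sup>+x. f x * ennreal (gauss_tilt s v x) \<partial>gauss s)"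
proof -
  have "(\<integral>\<^sup>+x. f x * ennreal (gauss_tilt s v x) \<partial>gauss s) =
      (\<integral>\<^sup>+x. ennreal (normal_density 0 s x) * (f x * ennreal (gauss_tilt s v x)) \<partial>lborel)"
    by (rule nn_integral_density) measurable
  also have "\<dots> = (\<integral>\<^sup>+x. ennreal (normal_density v s x) * f x \<partial>lborel)"
    by (intro nn_integral_cong, subst normal_density_tilt[OF s]) (simp add: ennreal_mult' ac_simps)
  finally show ?thesis unfolding nn_integral_gauss_shift[OF assms(2)] ..
qed

lemma restrict_insert_upd:
  assumes "i \<notin> I"
  shows "(\<lambda>l\<in>insert i I. (x(i := y)) l + v l) = (\<lambda>l\<in>I. x l + v l)(i := y + (v i :: 'a :: plus))"
  using assms by (auto simp: fun_eq_iff restrict_def)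

text \<open>The Cameron-Martin formula in finite dimension, by induction on the index set: the
  one-dimensional formula treats the inner integral over the new coordinate, the induction
  hypothesis the remaining ones.\<close>

lemma nn_integral_PiM_gauss_shift:
  assumes s: "s > 0" and "finite I" and "f \<in> borel_measurable (\<Pi>\<^sub>M l\<in>I. borel)"
  shows "(\<integral>\<^sup>+z. f (\<lambda>l\<in>I. z l + v l) \<partial>(\<Pi>\<^sub>M l\<in>I. gauss s)) =
    (\<integral>\<^sup>+z. f z * ennreal (\<Prod>l\<in>I. gauss_tilt s (v l) (z l)) \<partial>(\<Pi>\<^sub>M l\<in>I. gauss s))"
  using assms(2,3)
proof (induction I arbitrary: f)
  case empty
  then show ?case by (auto simp: space_PiM restrict_def PiM_empty nn_integral_count_space_finite)
next
  case (insert i I)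
  interpret N: prob_space "gauss s" using s by (rule prob_space_normal_density)
  interpret P: product_sigma_finite "\<lambda>_. gauss s" by unfold_locales
  have [measurable_cong]: "sets (gauss s) = sets borel" by simp
  note [measurable] = insert.prems
  have [measurable]: "f \<in> borel_measurable (\<Pi>\<^sub>M l\<in>insert i I. gauss s)" by measurable
  \<comment> \<open>The tilt of coordinate \<open>i\<close> is already included here, so that only a
    translation of the coordinates in \<open>I\<close> remains.\<close>
  define F where "F x = (\<integral>\<^sup>+y. f (x(i := y)) * ennreal (gauss_tilt s (v i) y) \<partial>gauss s)" for x
  have F [measurable]: "F \<in> borel_measurable (\<Pi>\<^sub>M l\<in>I. borel)"
    unfolding F_def by measurable
  have "(\<integral>\<^sup>+z. f (\<lambda>l\<in>insert i I. z l + v l) \<partial>(\<Pi>\<^sub>M l\<in>insert i I. gauss s)) =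
     (\<integral>\<^sup>+x. \<integral>\<^sup>+y. f (\<lambda>l\<in>insert i I. (x(i := y)) l + v l) \<partial>gauss s \<partial>(\<Pi>\<^sub>M l\<in>I. gauss s))"
    by (intro P.product_nn_integral_insert insert.hyps measurable_compose[OF _ insert.prems]) measurable
  also have "\<dots> = (\<integral>\<^sup>+x. \<integral>\<^sup>+y. f ((\<lambda>l\<in>I. x l + v l)(i := y + v i)) \<partial>gauss s \<partial>(\<Pi>\<^sub>M l\<in>I. gauss s))"
    by (simp only: restrict_insert_upd[OF insert.hyps(2)])
  also have "\<dots> = (\<integral>\<^sup>+x. F (\<lambda>l\<in>I. x l + v l) \<partial>(\<Pi>\<^sub>M l\<in>I. gauss s))"
    unfolding F_def
    by (intro nn_integral_cong nn_integral_gauss_shift_tilt[OF s]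
      measurable_compose[OF measurable_component_update[OF _ insert.hyps(2)] insert.prems]) (simp add: space_PiM)
  also have "\<dots> = (\<integral>\<^sup>+x. F x * ennreal (\<Prod>l\<in>I. gauss_tilt s (v l) (x l)) \<partial>(\<Pi>\<^sub>M l\<in>I. gauss s))"
    by (rule insert.IH[OF F])
  also have "\<dots> = (\<integral>\<^sup>+x. \<integral>\<^sup>+y. f (x(i := y)) * ennreal (gauss_tilt s (v i) y) * ennreal (\<Prod>l\<in>I. gauss_tilt s (v l) (x l))
      \<partial>gauss s \<partial>(\<Pi>\<^sub>M l\<in>I. gauss s))"
    unfolding F_def by (intro nn_integral_cong nn_integral_multc[symmetric]) measurable
  also have "\<dots> = (\<integral>\<^sup>+x. \<integral>\<^sup>+y. f (x(i := y)) * ennreal (\<Prod>l\<in>insert i I. gauss_tilt s (v l) ((x(i := y)) l))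
      \<partial>gauss s \<partial>(\<Pi>\<^sub>M l\<in>I. gauss s))"
  proof (intro nn_integral_cong)
    fix x y
    have "(\<Prod>l\<in>I. gauss_tilt s (v l) ((x(i := y)) l)) = (\<Prod>l\<in>I. gauss_tilt s (v l) (x l))"
      using insert.hyps by (intro prod.cong) auto
    then have "(\<Prod>l\<in>insert i I. gauss_tilt s (v l) ((x(i := y)) l)) = gauss_tilt s (v i) y * (\<Prod>l\<in>I. gauss_tilt s (v l) (x l))"
      using insert.hyps by simp
    then show "f (x(i := y)) * ennreal (gauss_tilt s (v i) y) * ennreal (\<Prod>l\<in>I. gauss_tilt s (v l) (x l)) =
      f (x(i := y)) * ennreal (\<Prod>l\<in>insert i I. gauss_tilt s (v l) ((x(i := y)) l))"
      by (simp add: ennreal_mult prod_nonneg mult.assoc)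
  qed
  also have "\<dots> = (\<integral>\<^sup>+z. f z * ennreal (\<Prod>l\<in>insert i I. gauss_tilt s (v l) (z l)) \<partial>(\<Pi>\<^sub>M l\<in>insert i I. gauss s))"
  proof (rule P.product_nn_integral_insert[symmetric, OF insert.hyps])
    have [measurable]: "(\<lambda>z. \<Prod>l\<in>insert i I. gauss_tilt s (v l) (z l)) \<in> borel_measurable (\<Pi>\<^sub>M l\<in>insert i I. gauss s)"
      by (intro borel_measurable_prod measurable_compose[OF measurable_component_singleton]) auto
    show "(\<lambda>z. f z * ennreal (\<Prod>l\<in>insert i I. gauss_tilt s (v l) (z l))) \<in> borel_measurable (\<Pi>\<^sub>M l\<in>insert i I. gauss s)"
      by measurable
  qed
  finally show ?case .
qed

section \<open>Expansion of a product of mixtures over the component labels\<close>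

lemma sum_PiE_insert:
  fixes f :: "('i \<Rightarrow> 'a) \<Rightarrow> 'b :: comm_monoid_add"
  assumes "i \<notin> I"
  shows "(\<Sum>b\<in>insert i I \<rightarrow>\<^sub>E S. f b) = (\<Sum>k\<in>S. \<Sum>b\<in>I \<rightarrow>\<^sub>E S. f (b(i := k)))"
proof -
  have "inj_on (\<lambda>(k, b). b(i := k)) (S \<times> (I \<rightarrow>\<^sub>E S))"
    using inj_combinator[OF assms, of "\<lambda>_. S"] by simp
  then show ?thesis
    by (simp add: PiE_insert_eq sum.reindex sum.cartesian_product case_prod_unfold)
qed

text \<open>Drawing from a product of mixtures amounts to drawing the labels \<open>b\<close>
  independently with weights \<open>w\<close> and then translating independent copies of
  \<open>N\<close> by \<open>m (b l)\<close>. The induction splits off one coordinate and, through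
  \<open>mix\<close>, its label.\<close>

lemma nn_integral_PiM_mixture:
  fixes w :: "'k \<Rightarrow> ennreal" and m :: "'k \<Rightarrow> real"
  assumes G: "prob_space G" and N: "prob_space N"
    and [measurable_cong]: "sets G = sets borel" "sets N = sets borel"
    and mix: "\<And>f. f \<in> borel_measurable borel \<Longrightarrow>
      (\<integral>\<^sup>+x. f x \<partial>G) = (\<Sum>k\<in>S. w k * (\<integral>\<^sup>+x. f (x + m k) \<partial>N))"
    and "finite I" and "f \<in> borel_measurable (\<Pi>\<^sub>M l\<in>I. borel)"
  shows "(\<integral>\<^sup>+x. f x \<partial>(\<Pi>\<^sub>M l\<in>I. G)) =
    (\<Sum>b\<in>I \<rightarrow>\<^sub>E S. (\<Prod>l\<in>I. w (b l)) * (\<integral>\<^sup>+x. f (\<lambda>l\<in>I. x l + m (b l)) \<partial>(\<Pi>\<^sub>M l\<in>I. N)))"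
  using assms(6,7)
proof (induction I arbitrary: f)
  case empty
  then show ?case by (auto simp: space_PiM restrict_def PiM_empty nn_integral_count_space_finite intro!: nn_integral_cong)
next
  case (insert i I)
  interpret G: prob_space G by fact
  interpret N: prob_space N by fact
  interpret PG: product_sigma_finite "\<lambda>_. G" by unfold_locales
  interpret PN: product_sigma_finite "\<lambda>_. N" by unfold_locales
  note [measurable] = insert.prems
  \<comment> \<open>The label of the new coordinate is frozen at \<open>k\<close>; the induction
    hypothesis is used once for each \<open>k\<close>, which is why \<open>f\<close> is arbitrary in
    the induction.\<close>
  define F where "F k x = (\<integral>\<^sup>+y. f (x(i := y + m k)) \<partial>N)" for k x
  have F [measurable]: "F k \<in> borel_measurable (\<Pi>\<^sub>M l\<in>I. borel)" for k
    unfolding F_def by measurable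
  have "(\<integral>\<^sup>+x. f x \<partial>(\<Pi>\<^sub>M l\<in>insert i I. G)) = (\<integral>\<^sup>+x. \<integral>\<^sup>+y. f (x(i := y)) \<partial>G \<partial>(\<Pi>\<^sub>M l\<in>I. G))"
    using insert.hyps by (intro PG.product_nn_integral_insert) measurable
  also have "\<dots> = (\<integral>\<^sup>+x. (\<Sum>k\<in>S. w k * F k x) \<partial>(\<Pi>\<^sub>M l\<in>I. G))"
    unfolding F_def
    by (intro nn_integral_cong mix
      measurable_compose[OF measurable_component_update[OF _ insert.hyps(2)] insert.prems])
      (simp add: space_PiM sets_eq_imp_space_eq[OF assms(3)])
  also have "\<dots> = (\<Sum>k\<in>S. w k * (\<integral>\<^sup>+x. F k x \<partial>(\<Pi>\<^sub>M l\<in>I. G)))"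
    by (subst nn_integral_sum) (auto intro!: sum.cong nn_integral_cmult)
  also have "\<dots> = (\<Sum>k\<in>S. w k * (\<Sum>b\<in>I \<rightarrow>\<^sub>E S. (\<Prod>l\<in>I. w (b l)) * (\<integral>\<^sup>+x. F k (\<lambda>l\<in>I. x l + m (b l)) \<partial>(\<Pi>\<^sub>M l\<in>I. N))))"
    by (simp only: insert.IH[OF F])
  also have "\<dots> = (\<Sum>k\<in>S. \<Sum>b\<in>I \<rightarrow>\<^sub>E S. (\<Prod>l\<in>insert i I. w ((b(i := k)) l)) *
      (\<integral>\<^sup>+x. f (\<lambda>l\<in>insert i I. x l + m ((b(i := k)) l)) \<partial>(\<Pi>\<^sub>M l\<in>insert i I. N)))"
    unfolding sum_distrib_left
  proof (intro sum.cong refl)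
    fix k b
    have "(\<Prod>l\<in>I. w ((b(i := k)) l)) = (\<Prod>l\<in>I. w (b l))"
      using insert.hyps by (intro prod.cong) auto
    then have 1: "(\<Prod>l\<in>insert i I. w ((b(i := k)) l)) = w k * (\<Prod>l\<in>I. w (b l))"
      using insert.hyps by simp
    have eq: "(\<lambda>l\<in>insert i I. (x(i := y)) l + m ((b(i := k)) l)) = (\<lambda>l\<in>I. x l + m (b l))(i := y + m k)" for x y
      using insert.hyps by (auto simp: fun_eq_iff restrict_def)
    have 2: "(\<integral>\<^sup>+x. F k (\<lambda>l\<in>I. x l + m (b l)) \<partial>(\<Pi>\<^sub>M l\<in>I. N)) =
      (\<integral>\<^sup>+x. f (\<lambda>l\<in>insert i I. x l + m ((b(i := k)) l)) \<partial>(\<Pi>\<^sub>M l\<in>insert i I. N))"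
      unfolding F_def eq[symmetric]
      using insert.hyps by (intro PN.product_nn_integral_insert[symmetric]) (auto intro!: measurable_compose[OF _ insert.prems])
    show "w k * ((\<Prod>l\<in>I. w (b l)) * (\<integral>\<^sup>+x. F k (\<lambda>l\<in>I. x l + m (b l)) \<partial>(\<Pi>\<^sub>M l\<in>I. N))) =
      (\<Prod>l\<in>insert i I. w ((b(i := k)) l)) *
      (\<integral>\<^sup>+x. f (\<lambda>l\<in>insert i I. x l + m ((b(i := k)) l)) \<partial>(\<Pi>\<^sub>M l\<in>insert i I. N))"
      unfolding 1 2 by (simp add: mult.assoc)
  qed
  finally show ?case unfolding sum_PiE_insert[OF insert.hyps(2)] .
qed

section \<open>Replacing a product weight one coordinate at a time\<close>

lemma prod_upd_insert:
  fixes h :: "'k \<Rightarrow> 'b :: comm_monoid_mult"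
  assumes "finite I" "i \<notin> I"
  shows "(\<Prod>l\<in>insert i I. h ((b(i := k)) l)) = h k * (\<Prod>l\<in>I. h (b l))"
proof -
  have "(\<Prod>l\<in>I. h ((b(i := k)) l)) = (\<Prod>l\<in>I. h (b l))"
    using assms by (intro prod.cong) auto
  then show ?thesis using assms by simp
qed

text \<open>A telescoping argument: exchanging \<open>h\<close> for \<open>h'\<close> in one
  coordinate costs at most \<open>D\<close> after averaging over the other labels, and there are
  \<open>card I\<close> exchanges. The bound is assumed for every \<open>b\<close>, so that it
  passes to \<open>Q\<close> with some coordinates already fixed.\<close>

lemma product_weights_replacement:
  fixes h h' :: "'k \<Rightarrow> real" and Q :: "('i \<Rightarrow> 'k) \<Rightarrow> real"
  assumes "finite I" and S: "finite S"
    and h: "\<And>k. k \<in> S \<Longrightarrow> 0 \<le> h k" "(\<Sum>k\<in>S. h k) = 1"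
    and h': "\<And>k. k \<in> S \<Longrightarrow> 0 \<le> h' k" "(\<Sum>k\<in>S. h' k) = 1"
    and "\<And>b j. j \<in> I \<Longrightarrow> \<bar>\<Sum>k\<in>S. (h k - h' k) * Q (b(j := k))\<bar> \<le> D"
  shows "\<bar>(\<Sum>b\<in>I \<rightarrow>\<^sub>E S. (\<Prod>l\<in>I. h (b l)) * Q b) - (\<Sum>b\<in>I \<rightarrow>\<^sub>E S. (\<Prod>l\<in>I. h' (b l)) * Q b)\<bar>
    \<le> real (card I) * D"
  using assms(1,7)
proof (induction I arbitrary: Q)
  case empty
  then show ?case by simp
next
  case (insert i I)
  define P where "P q = (\<Sum>b\<in>I \<rightarrow>\<^sub>E S. (\<Prod>l\<in>I. h (b l)) * q b)" for q :: "('i \<Rightarrow> 'k) \<Rightarrow> real"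
  define P' where "P' q = (\<Sum>b\<in>I \<rightarrow>\<^sub>E S. (\<Prod>l\<in>I. h' (b l)) * q b)" for q :: "('i \<Rightarrow> 'k) \<Rightarrow> real"
  define R where "R k b = Q (b(i := k))" for k b
  have IH: "\<bar>P (R k) - P' (R k)\<bar> \<le> real (card I) * D" for k
    unfolding P_def P'_def
  proof (rule insert.IH)
    fix b j assume "j \<in> I"
    then have "j \<noteq> i" using insert.hyps by auto
    \<comment> \<open>The two updates commute because \<open>j\<close> differs from
      \<open>i\<close>, so the hypothesis on \<open>Q\<close> at \<open>b(i := k)\<close> yields the
      one on \<open>R k\<close>.\<close>
    then have "R k (b(j := k')) = Q (b(i := k, j := k'))" for k'
      unfolding R_def by (subst fun_upd_twist) auto
    then show "\<bar>\<Sum>k'\<in>S. (h k' - h' k') * R k (b(j := k'))\<bar> \<le> D"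
      using insert.prems[of j "b(i := k)"] \<open>j \<in> I\<close> by (simp only: insertI2)
  qed
  \<comment> \<open>Total mass 1 makes the average of a quantity bounded by \<open>D\<close> again
    bounded by \<open>D\<close>.\<close>
  have mass: "(\<Sum>b\<in>I \<rightarrow>\<^sub>E S. \<Prod>l\<in>I. h' (b l)) = 1"
    using prod_sum_PiE[of I "\<lambda>_. S" "\<lambda>_. h'"] insert.hyps S h' by simp
  have "(\<Sum>k\<in>S. (h k - h' k) * P' (R k)) = P' (\<lambda>b. \<Sum>k\<in>S. (h k - h' k) * R k b)"
    unfolding P'_def sum_distrib_left by (subst sum.swap) (simp add: mult_ac)
  also have "\<bar>\<dots>\<bar> \<le> (\<Sum>b\<in>I \<rightarrow>\<^sub>E S. \<bar>(\<Prod>l\<in>I. h' (b l)) * (\<Sum>k\<in>S. (h k - h' k) * R k b)\<bar>)"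
    unfolding P'_def by (rule sum_abs)
  also have "\<dots> \<le> (\<Sum>b\<in>I \<rightarrow>\<^sub>E S. (\<Prod>l\<in>I. h' (b l)) * D)"
  proof (rule sum_mono)
    fix b assume "b \<in> I \<rightarrow>\<^sub>E S"
    then have "0 \<le> (\<Prod>l\<in>I. h' (b l))" by (intro prod_nonneg) (auto intro: h')
    moreover have "\<bar>\<Sum>k\<in>S. (h k - h' k) * R k b\<bar> \<le> D"
      using insert.prems[of i b] by (simp only: R_def insertI1)
    ultimately show "\<bar>(\<Prod>l\<in>I. h' (b l)) * (\<Sum>k\<in>S. (h k - h' k) * R k b)\<bar> \<le> (\<Prod>l\<in>I. h' (b l)) * D"
      by (simp add: abs_mult mult_left_mono)
  qed
  also have "\<dots> = D" by (simp add: sum_distrib_right[symmetric] mass)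
  finally have 2: "\<bar>\<Sum>k\<in>S. (h k - h' k) * P' (R k)\<bar> \<le> D" .
  have "\<bar>\<Sum>k\<in>S. h k * (P (R k) - P' (R k))\<bar> \<le> (\<Sum>k\<in>S. \<bar>h k * (P (R k) - P' (R k))\<bar>)"
    by (rule sum_abs)
  also have "\<dots> \<le> (\<Sum>k\<in>S. h k * (real (card I) * D))"
    by (intro sum_mono) (auto simp: abs_mult h intro!: mult_left_mono IH)
  also have "\<dots> = real (card I) * D" using h by (simp add: sum_distrib_right[symmetric])
  finally have 1: "\<bar>\<Sum>k\<in>S. h k * (P (R k) - P' (R k))\<bar> \<le> real (card I) * D" .
  have eq: "(\<Sum>b\<in>insert i I \<rightarrow>\<^sub>E S. (\<Prod>l\<in>insert i I. h (b l)) * Q b) = (\<Sum>k\<in>S. h k * P (R k))"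
    "(\<Sum>b\<in>insert i I \<rightarrow>\<^sub>E S. (\<Prod>l\<in>insert i I. h' (b l)) * Q b) = (\<Sum>k\<in>S. h' k * P' (R k))"
    unfolding sum_PiE_insert[OF insert.hyps(2)] prod_upd_insert[OF insert.hyps] P_def P'_def R_def
    by (simp_all add: sum_distrib_left mult.assoc)
  \<comment> \<open>The old coordinates are exchanged first, with \<open>h\<close> kept on the new
    one; then the new one is exchanged with \<open>h'\<close> already on the others.\<close>
  have "(\<Sum>k\<in>S. h k * P (R k)) - (\<Sum>k\<in>S. h' k * P' (R k)) =
      (\<Sum>k\<in>S. h k * (P (R k) - P' (R k))) + (\<Sum>k\<in>S. (h k - h' k) * P' (R k))"
    unfolding sum_subtractf[symmetric] sum.distrib[symmetric] by (intro sum.cong) (auto simp: algebra_simps)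
  then show ?case unfolding eq using 1 2 insert.hyps by (simp add: algebra_simps)
qed

section \<open>Second-moment bounds for signed mixtures\<close>

text \<open>The integral over \<open>A\<close> of the signed mixture \<open>f\<close> of the
  functions \<open>W k\<close> is at most its L1 norm, hence at most its L2 norm on a probability
  space, and the square of the latter is the quadratic form of the Gram matrix
  \<open>E\<close>.\<close>

lemma (in prob_space) weighted_event_bound:
  fixes W :: "'k \<Rightarrow> 'a \<Rightarrow> real"
  assumes W [measurable]: "\<And>k. W k \<in> borel_measurable M" and W0: "\<And>k x. 0 \<le> W k x"
    and E0: "\<And>j k. 0 \<le> E j k"
    and E: "\<And>j k. (\<integral>\<^sup>+x. ennreal (W j x * W k x) \<partial>M) = ennreal (E j k)"
    and A [measurable]: "A \<in> sets M"
  shows "\<bar>\<Sum>k\<in>S. \<mu> k * (\<integral>x. indicator A x * W k x \<partial>M)\<bar> \<le> sqrt (\<Sum>j\<in>S. \<Sum>k\<in>S. \<mu> j * \<mu> k * E j k)"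
proof -
  have "integrable M (\<lambda>x. W j x * W k x) \<and> (\<integral>x. W j x * W k x \<partial>M) = E j k" for j k
    by (rule iffD1[OF nn_integral_eq_integrable E]) (auto simp: W0 E0)
  then have WW: "integrable M (\<lambda>x. W j x * W k x)" "(\<integral>x. W j x * W k x \<partial>M) = E j k" for j k
    by blast+
  have W_int: "integrable M (W k)" for k
    by (rule square_integrable_imp_integrable[OF W]) (unfold power2_eq_square, rule WW(1))
  define f where "f x = (\<Sum>k\<in>S. \<mu> k * W k x)" for x
  have f_int: "integrable M f" unfolding f_def by (intro Bochner_Integration.integrable_sum integrable_mult_right W_int)
  have f2: "(f x)\<^sup>2 = (\<Sum>j\<in>S. \<Sum>k\<in>S. \<mu> j * \<mu> k * (W j x * W k x))" for x
    unfolding f_def power2_eq_square sum_product by (intro sum.cong refl) (simp only: mult_ac)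
  have f2_int: "integrable M (\<lambda>x. (f x)\<^sup>2)" unfolding f2 by (intro Bochner_Integration.integrable_sum integrable_mult_right WW)
  \<comment> \<open>The Cauchy-Schwarz inequality, in the form that the variance of the absolute
    value of \<open>f\<close> is nonnegative.\<close>
  have "(\<integral>x. \<bar>f x\<bar> \<partial>M)\<^sup>2 \<le> (\<integral>x. (f x)\<^sup>2 \<partial>M)"
    using variance_positive[of "\<lambda>x. \<bar>f x\<bar>"] variance_eq[of "\<lambda>x. \<bar>f x\<bar>"] f_int f2_int by simp
  also have "\<dots> = (\<Sum>j\<in>S. \<Sum>k\<in>S. \<mu> j * \<mu> k * E j k)"
    unfolding f2 by (simp add: Bochner_Integration.integral_sum Bochner_Integration.integrable_sum WW)
  finally have le: "(\<integral>x. \<bar>f x\<bar> \<partial>M) \<le> sqrt (\<Sum>j\<in>S. \<Sum>k\<in>S. \<mu> j * \<mu> k * E j k)"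
    by (rule real_le_rsqrt)
  have int_A: "integrable M (\<lambda>x. indicator A x * W k x)" for k
    by (rule Bochner_Integration.integrable_bound[OF W_int]) (auto simp: indicator_def)
  have "(\<Sum>k\<in>S. \<mu> k * (\<integral>x. indicator A x * W k x \<partial>M)) = (\<integral>x. (\<Sum>k\<in>S. \<mu> k * (indicator A x * W k x)) \<partial>M)"
    by (simp add: Bochner_Integration.integral_sum int_A)
  also have "\<dots> = (\<integral>x. indicator A x * f x \<partial>M)"
    unfolding f_def sum_distrib_left by (intro Bochner_Integration.integral_cong refl sum.cong) (simp only: mult_ac)
  also have "\<bar>\<dots>\<bar> \<le> (\<integral>x. \<bar>f x\<bar> \<partial>M)"
  proof -
    have "\<bar>\<integral>x. indicator A x * f x \<partial>M\<bar> \<le> (\<integral>x. \<bar>indicator A x * f x\<bar> \<partial>M)"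
      by (rule integral_abs_bound)
    also have "\<dots> \<le> (\<integral>x. \<bar>f x\<bar> \<partial>M)"
      using f_int by (intro integral_mono') (auto simp: abs_mult indicator_def)
    finally show ?thesis .
  qed
  finally show ?thesis using le by linarith
qed

text \<open>For positive \<open>K\<close> this is the difference of the laws of a fair binomial
  variable conditioned on even and on odd values; the factor 2 arises because each parity has
  probability 1/2.\<close>

definition alternating_weight :: "nat \<Rightarrow> nat \<Rightarrow> real" where
  "alternating_weight K k = 2 * (- 1) ^ k * real (K choose k) / 2 ^ K"

text \<open>The binomial theorem at \<open>- x\<close>. The zero of order \<open>K\<close> at
  \<open>x = 1\<close> expresses that the moments of order less than \<open>K\<close>
  vanish.\<close>

lemma sum_alternating_weight_power:
  "(\<Sum>k\<le>K. alternating_weight K k * x ^ k) = 2 / 2 ^ K * (1 - x) ^ K"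
proof -
  have "(1 - x) ^ K = (\<Sum>k\<le>K. real (K choose k) * (- x) ^ k)"
    using binomial_ring[of "- x" 1 K] by simp
  also have "2 / 2 ^ K * \<dots> = (\<Sum>k\<le>K. alternating_weight K k * x ^ k)"
    unfolding sum_distrib_left alternating_weight_def
    by (intro sum.cong) (auto simp: power_minus[of x])
  finally show ?thesis by simp
qed

text \<open>Since exp(s j k) is the k-th power of exp(s j), the inner sum is a multiple of (1 -
  exp(s j))^K, which is at most (2 r^2)^K in absolute value. With the outer weights also replaced by
  absolute values, the powers of 2 cancel against the normalisations and 4 r^(2K) is left.\<close>

lemma alternating_weight_quadratic_form:
  assumes s: "0 \<le> s" "s * real K \<le> r\<^sup>2" and r: "0 \<le> r" "r \<le> 1"
  shows "(\<Sum>j\<le>K. \<Sum>k\<le>K. alternating_weight K j * alternating_weight K k * exp (s * real j * real k)) \<le> (2 * r ^ K)\<^sup>2"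
proof -
  have r2: "r\<^sup>2 \<le> 1" using r by (simp add: power_le_one)
  have bound: "\<bar>1 - exp (s * real j)\<bar> \<le> 2 * r\<^sup>2" if "j \<le> K" for j
  proof -
    have x: "0 \<le> s * real j" "s * real j \<le> r\<^sup>2"
      using s that mult_left_mono[of "real j" "real K" s] by auto
    \<comment> \<open>The quadratic bound on exp holds on [0, 1], where the square is at most the
      argument x, so that exp(x) - 1 is at most 2 x.\<close>
    then have "exp (s * real j) \<le> 1 + s * real j + (s * real j)\<^sup>2"
      using r2 by (intro exp_bound) auto
    moreover have "(s * real j)\<^sup>2 \<le> s * real j"
      using x r2 by (simp add: power2_eq_square mult_left_le)
    moreover have "1 \<le> exp (s * real j)" using x by simp
    ultimately show ?thesis using x by linarith
  qed
  have "(\<Sum>j\<le>K. \<Sum>k\<le>K. alternating_weight K j * alternating_weight K k * exp (s * real j * real k)) =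
      (\<Sum>j\<le>K. alternating_weight K j * (\<Sum>k\<le>K. alternating_weight K k * exp (s * real j) ^ k))"
    unfolding sum_distrib_left by (simp add: exp_of_nat_mult[symmetric] mult_ac)
  also have "\<dots> = (\<Sum>j\<le>K. alternating_weight K j * (2 / 2 ^ K * (1 - exp (s * real j)) ^ K))"
    by (simp only: sum_alternating_weight_power)
  also have "\<dots> \<le> (\<Sum>j\<le>K. 2 * real (K choose j) / 2 ^ K * (2 / 2 ^ K * (2 * r\<^sup>2) ^ K))"
  proof (rule sum_mono)
    fix j assume "j \<in> {..K}"
    then have "\<bar>1 - exp (s * real j)\<bar> ^ K \<le> (2 * r\<^sup>2) ^ K"
      by (intro power_mono bound) auto
    have "alternating_weight K j * (2 / 2 ^ K * (1 - exp (s * real j)) ^ K) \<le>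
      \<bar>alternating_weight K j * (2 / 2 ^ K * (1 - exp (s * real j)) ^ K)\<bar>" by (rule abs_ge_self)
    also have "\<dots> = 2 * real (K choose j) / 2 ^ K * (2 / 2 ^ K * \<bar>1 - exp (s * real j)\<bar> ^ K)"
      by (simp add: alternating_weight_def abs_mult power_abs)
    also have "\<dots> \<le> 2 * real (K choose j) / 2 ^ K * (2 / 2 ^ K * (2 * r\<^sup>2) ^ K)"
      by (intro mult_left_mono) (use \<open>\<bar>1 - exp (s * real j)\<bar> ^ K \<le> (2 * r\<^sup>2) ^ K\<close> in auto)
    finally show "alternating_weight K j * (2 / 2 ^ K * (1 - exp (s * real j)) ^ K) \<le>
      2 * real (K choose j) / 2 ^ K * (2 / 2 ^ K * (2 * r\<^sup>2) ^ K)" .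
  qed
  also have "\<dots> = (\<Sum>j\<le>K. real (K choose j)) * (2 / 2 ^ K * (2 / 2 ^ K * (2 * r\<^sup>2) ^ K))"
    unfolding sum_distrib_right by (intro sum.cong) auto
  also have "(\<Sum>j\<le>K. real (K choose j)) = 2 ^ K"
    using choose_row_sum[of K] by (metis of_nat_sum of_nat_power of_nat_numeral)
  also have "2 ^ K * (2 / 2 ^ K * (2 / 2 ^ K * (2 * r\<^sup>2) ^ K)) = (2 * r ^ K)\<^sup>2"
    by (simp add: power_mult_distrib power_mult[symmetric] mult.commute)
  finally show ?thesis .
qed

section \<open>Least-energy splitting of a design column\<close>

lemma scalar_prod_self_eq: "v \<bullet> v = (\<Sum>i<dim_vec v. (v $ i)\<^sup>2)" for v :: "real vec"
  by (simp add: scalar_prod_def power2_eq_square atLeast0LessThan)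

text \<open>For the column x and u = (X X^T + \<sigma>^2 I)^(-1) x, the choice v = X^T u and e =
  \<sigma>^2 u gives x = X v + e with energy <x, u>, the squared norm of the whitened column. Here
  \<open>v\<close> will translate the coefficients and \<open>e\<close> the noise, and the energy is
  the Cameron-Martin cost of that translation.\<close>

lemma whitened_column_representation:
  assumes X: "X \<in> carrier_mat n p" and \<sigma>: "\<sigma> > 0" and j: "j < p"
  obtains v e :: "nat \<Rightarrow> real"
  where "\<And>i. i < n \<Longrightarrow> (\<Sum>l<p. X $$ (i, l) * v l) + e i = X $$ (i, j)"
    and "(\<Sum>l<p. (v l)\<^sup>2) + (\<Sum>i<n. (e i)\<^sup>2) / \<sigma>\<^sup>2 =
      (euclidean_norm_vec (whitened_design X \<sigma> *\<^sub>v unit_vec p j))\<^sup>2"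
proof -
  let ?B = "X * X\<^sup>T + \<sigma>\<^sup>2 \<cdot>\<^sub>m 1\<^sub>m n"
  have B: "?B \<in> carrier_mat n n" using X by simp
  define S where "S = inv_sqrt_mat ?B"
  have S: "S \<in> carrier_mat n n" "S\<^sup>T = S" "?B * (S * S) = 1\<^sub>m n"
    using inv_sqrt_mat[OF B positive_definite_gram_plus_noise[OF X \<sigma>]]
    by (auto simp: S_def positive_definite_mat_def)
  define x where "x = col X j"
  have x: "x \<in> carrier_vec n" unfolding x_def using X by (intro carrier_vecI) simp
  \<comment> \<open>Two factors \<open>S\<close> make up the inverse of \<open>?B\<close>; keeping
    them apart turns <x, u> into the squared norm of \<open>S\<close> applied to
    \<open>x\<close>.\<close>
  define u where "u = S *\<^sub>v (S *\<^sub>v x)"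
  have u: "u \<in> carrier_vec n" using S x by (simp add: u_def)
  have Bu: "?B *\<^sub>v u = x"
  proof -
    have "u = (S * S) *\<^sub>v x"
      unfolding u_def using S x by (intro assoc_mult_mat_vec[symmetric, of _ n n _ n]) auto
    then have "?B *\<^sub>v u = ?B *\<^sub>v ((S * S) *\<^sub>v x)" by (rule arg_cong)
    also have "\<dots> = (?B * (S * S)) *\<^sub>v x"
      using B S(1) x by (intro assoc_mult_mat_vec[symmetric, of _ n n _ n]) auto
    also have "\<dots> = x" unfolding S(3) using x by simp
    finally show ?thesis .
  qed
  have Bu': "?B *\<^sub>v u = X *\<^sub>v (X\<^sup>T *\<^sub>v u) + \<sigma>\<^sup>2 \<cdot>\<^sub>v u"
  proof -
    have "?B *\<^sub>v u = (X * X\<^sup>T) *\<^sub>v u + (\<sigma>\<^sup>2 \<cdot>\<^sub>m 1\<^sub>m n) *\<^sub>v u"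
      using X u by (intro add_mult_distrib_mat_vec[of _ n n]) auto
    also have "(X * X\<^sup>T) *\<^sub>v u = X *\<^sub>v (X\<^sup>T *\<^sub>v u)"
      using X u by (intro assoc_mult_mat_vec[of _ n p _ n]) auto
    also have "(\<sigma>\<^sup>2 \<cdot>\<^sub>m 1\<^sub>m n) *\<^sub>v u = \<sigma>\<^sup>2 \<cdot>\<^sub>v u"
      using u by (intro eq_vecI) (auto simp: smult_scalar_prod_distrib[of _ n])
    finally show ?thesis .
  qed
  define v where "v = X\<^sup>T *\<^sub>v u"
  have v: "v \<in> carrier_vec p" using X u by (simp add: v_def)
  have xeq: "x = X *\<^sub>v v + \<sigma>\<^sup>2 \<cdot>\<^sub>v u" using Bu Bu' by (simp add: v_def)
  have "whitened_design X \<sigma> *\<^sub>v unit_vec p j = S *\<^sub>v (X *\<^sub>v unit_vec p j)"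
    unfolding whitened_design_def using X S(1) by (simp add: S_def assoc_mult_mat_vec[of _ n n _ p])
  also have "X *\<^sub>v unit_vec p j = x"
    unfolding x_def by (rule eq_vecI) (use X j in \<open>auto simp: scalar_prod_def unit_vec_def if_distrib cong: if_cong\<close>)
  finally have "(euclidean_norm_vec (whitened_design X \<sigma> *\<^sub>v unit_vec p j))\<^sup>2 = (S *\<^sub>v x) \<bullet> (S *\<^sub>v x)"
    unfolding euclidean_norm_vec_def by (simp add: scalar_prod_self_eq sum_nonneg)
  also have "\<dots> = x \<bullet> u"
    unfolding u_def using sym_scalar[OF S(1,2) x, of "S *\<^sub>v x"] S x by simp
  also have "\<dots> = (X *\<^sub>v v) \<bullet> u + \<sigma>\<^sup>2 * (u \<bullet> u)"
    using X u v by (subst xeq) (simp add: add_scalar_prod_distrib[of _ n])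
  \<comment> \<open>Moving \<open>X\<close> to the other argument gives X^T u, which is
    \<open>v\<close> itself.\<close>
  also have "(X *\<^sub>v v) \<bullet> u = v \<bullet> v"
    using X u v transpose_vec_mult_scalar[of X n p v u] comm_scalar_prod[of "X *\<^sub>v v" n u]
    by (simp add: v_def)
  finally have norm: "(euclidean_norm_vec (whitened_design X \<sigma> *\<^sub>v unit_vec p j))\<^sup>2 = v \<bullet> v + \<sigma>\<^sup>2 * (u \<bullet> u)" .
  show thesis
  proof (rule that[of "\<lambda>l. v $ l" "\<lambda>i. \<sigma>\<^sup>2 * u $ i"])
    fix i assume i: "i < n"
    show "(\<Sum>l<p. X $$ (i, l) * v $ l) + \<sigma>\<^sup>2 * u $ i = X $$ (i, j)"
      using arg_cong[OF xeq, of "\<lambda>w. w $ i"] i j X u v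
      by (simp add: x_def scalar_prod_def atLeast0LessThan)
  next
    have "(\<Sum>i<n. (\<sigma>\<^sup>2 * u $ i)\<^sup>2) / \<sigma>\<^sup>2 = \<sigma>\<^sup>2 * (\<Sum>i<n. (u $ i)\<^sup>2)"
      unfolding sum_divide_distrib sum_distrib_left
      using \<sigma> by (intro sum.cong refl) (simp add: power2_eq_square)
    then show "(\<Sum>l<p. (v $ l)\<^sup>2) + (\<Sum>i<n. (\<sigma>\<^sup>2 * u $ i)\<^sup>2) / \<sigma>\<^sup>2 =
      (euclidean_norm_vec (whitened_design X \<sigma> *\<^sub>v unit_vec p j))\<^sup>2"
      unfolding norm scalar_prod_self_eq using u v by simp
  qed
qed

section \<open>Gaussian mixtures as priors: integrals, moments and distinctness\<close>

definition gauss_mix :: "(nat \<Rightarrow> real) \<Rightarrow> nat \<Rightarrow> real measure" where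
  "gauss_mix w K = density lborel
     (\<lambda>x. ennreal (\<Sum>k\<le>K. w k * normal_density (real k / (4 * real K)) (2 / 5) x))"

lemma sets_gauss_mix [simp]: "sets (gauss_mix w K) = sets borel"
  by (simp add: gauss_mix_def)

text \<open>Every component is a translate of one centred Gaussian, so the mixture meets the
  hypothesis \<open>mix\<close> of \<open>nn_integral_PiM_mixture\<close>.\<close>

lemma nn_integral_gauss_mix:
  assumes w: "\<And>k. 0 \<le> w k" and f [measurable]: "f \<in> borel_measurable borel"
  shows "(\<integral>\<^sup>+x. f x \<partial>gauss_mix w K) =
    (\<Sum>k\<le>K. ennreal (w k) * (\<integral>\<^sup>+x. f (x + real k / (4 * real K)) \<partial>gauss (2 / 5)))"
proof -
  let ?d = "\<lambda>k. normal_density (real k / (4 * real K)) (2 / 5)"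
  have "(\<integral>\<^sup>+x. f x \<partial>gauss_mix w K) = (\<integral>\<^sup>+x. ennreal (\<Sum>k\<le>K. w k * ?d k x) * f x \<partial>lborel)"
    unfolding gauss_mix_def by (rule nn_integral_density) measurable
  also have "\<dots> = (\<integral>\<^sup>+x. (\<Sum>k\<le>K. ennreal (w k) * (ennreal (?d k x) * f x)) \<partial>lborel)"
  proof (rule nn_integral_cong)
    fix x
    have "ennreal (\<Sum>k\<le>K. w k * ?d k x) = (\<Sum>k\<le>K. ennreal (w k * ?d k x))"
      by (rule sum_ennreal[symmetric]) (simp add: w)
    also have "\<dots> = (\<Sum>k\<le>K. ennreal (w k) * ennreal (?d k x))"
      by (intro sum.cong refl ennreal_mult w) simp
    finally show "ennreal (\<Sum>k\<le>K. w k * ?d k x) * f x = (\<Sum>k\<le>K. ennreal (w k) * (ennreal (?d k x) * f x))"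
      by (simp only: sum_distrib_right mult.assoc)
  qed
  also have "\<dots> = (\<Sum>k\<le>K. \<integral>\<^sup>+x. ennreal (w k) * (ennreal (?d k x) * f x) \<partial>lborel)"
    by (rule nn_integral_sum) measurable
  also have "\<dots> = (\<Sum>k\<le>K. ennreal (w k) * (\<integral>\<^sup>+x. ennreal (?d k x) * f x \<partial>lborel))"
    by (intro sum.cong refl nn_integral_cmult) measurable
  finally show ?thesis by (simp only: nn_integral_gauss_shift[OF f])
qed

lemma nn_integral_gauss_tilt:
  assumes "s > 0"
  shows "(\<integral>\<^sup>+x. ennreal (gauss_tilt s v x) \<partial>gauss s) = 1"
proof -
  interpret prob_space "gauss s" using assms by (rule prob_space_normal_density)
  show ?thesis
    using nn_integral_gauss_shift_tilt[OF assms, of "\<lambda>_. 1" v] emeasure_space_1 by simp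
qed

lemma real_distribution_gauss_mix:
  assumes w: "\<And>k. 0 \<le> w k" "(\<Sum>k\<le>K. w k) = 1"
  shows "real_distribution (gauss_mix w K)"
proof -
  interpret N: prob_space "gauss (2 / 5)" by (rule prob_space_normal_density) simp
  have "emeasure (gauss_mix w K) (space (gauss_mix w K)) = (\<integral>\<^sup>+x. 1 \<partial>gauss_mix w K)"
    by simp
  also have "\<dots> = (\<Sum>k\<le>K. ennreal (w k))"
    using nn_integral_gauss_mix[of w "\<lambda>_. 1"] w N.emeasure_space_1 by simp
  also have "\<dots> = 1" using w by (simp add: sum_ennreal)
  finally have "prob_space (gauss_mix w K)" by (rule prob_spaceI)
  then show ?thesis by (simp add: real_distribution_def real_distribution_axioms_def)
qed

lemma gauss_mix_integral:
  fixes f :: "real \<Rightarrow> real"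
  assumes w: "\<And>k. 0 \<le> w k" and f [measurable]: "f \<in> borel_measurable borel"
    and int: "\<And>k. k \<le> K \<Longrightarrow> integrable lborel (\<lambda>x. normal_density (real k / (4 * real K)) (2 / 5) x * f x)"
  shows "integrable (gauss_mix w K) f"
    and "(\<integral>x. f x \<partial>gauss_mix w K) =
      (\<Sum>k\<le>K. w k * (\<integral>x. normal_density (real k / (4 * real K)) (2 / 5) x * f x \<partial>lborel))"
proof -
  let ?d = "\<lambda>k. normal_density (real k / (4 * real K)) (2 / 5)"
  have nn: "AE x in lborel. 0 \<le> (\<Sum>k\<le>K. w k * ?d k x)"
    using w by (intro AE_I2 sum_nonneg mult_nonneg_nonneg) auto
  have eq: "(\<Sum>k\<le>K. w k * ?d k x) *\<^sub>R f x = (\<Sum>k\<le>K. w k * (?d k x * f x))" for x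
    by (simp add: sum_distrib_right mult.assoc)
  have int': "integrable lborel (\<lambda>x. w k * (?d k x * f x))" if "k \<in> {..K}" for k
    using int that by auto
  have "integrable lborel (\<lambda>x. (\<Sum>k\<le>K. w k * (?d k x * f x)))"
    by (intro Bochner_Integration.integrable_sum int')
  then show "integrable (gauss_mix w K) f"
    unfolding gauss_mix_def by (subst integrable_density) (use nn eq in auto)
  have "(\<integral>x. f x \<partial>gauss_mix w K) = (\<integral>x. (\<Sum>k\<le>K. w k * (?d k x * f x)) \<partial>lborel)"
    unfolding gauss_mix_def by (subst integral_density) (use nn eq in auto)
  also have "\<dots> = (\<Sum>k\<le>K. \<integral>x. w k * (?d k x * f x) \<partial>lborel)"
    by (rule Bochner_Integration.integral_sum[OF int'])
  finally show "(\<integral>x. f x \<partial>gauss_mix w K) = (\<Sum>k\<le>K. w k * (\<integral>x. ?d k x * f x \<partial>lborel))"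
    by simp
qed

text \<open>With u = x^2 / q the claim is the q-th power of 2 sqrt(u) \<le> exp(u), which follows
  from 4 u \<le> (1 + u)^2. The exponential factor no longer depends on \<open>q\<close>, so one
  change of Gaussian variance handles all moments.\<close>

lemma abs_power_le_exp_square:
  assumes q: "q \<ge> 1"
  shows "\<bar>x\<bar> ^ q \<le> (sqrt (real q) / 2) ^ q * exp (x\<^sup>2)"
proof -
  define u where "u = x\<^sup>2 / real q"
  have u: "0 \<le> u" "real q * u = x\<^sup>2" using q by (auto simp: u_def)
  have "(2 * sqrt u)\<^sup>2 \<le> (exp u)\<^sup>2"
  proof -
    have "(2 * sqrt u)\<^sup>2 = 4 * u" using u by (simp add: power_mult_distrib)
    also have "\<dots> \<le> (1 + u)\<^sup>2" using zero_le_power2[of "1 - u"] by (simp add: power2_eq_square algebra_simps)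
    also have "\<dots> \<le> (exp u)\<^sup>2" using u by (intro power_mono) auto
    finally show ?thesis .
  qed
  then have "2 * sqrt u \<le> exp u" by (rule power2_le_imp_le) simp
  moreover have "\<bar>x\<bar> = sqrt (real q) * sqrt u"
    by (simp add: real_sqrt_mult[symmetric] u)
  ultimately have "\<bar>x\<bar> \<le> sqrt (real q) / 2 * exp u"
    using mult_left_mono[of "2 * sqrt u" "exp u" "sqrt (real q) / 2"] by simp
  then have "\<bar>x\<bar> ^ q \<le> (sqrt (real q) / 2 * exp u) ^ q" by (intro power_mono) auto
  also have "\<dots> = (sqrt (real q) / 2) ^ q * exp (x\<^sup>2)"
    by (simp only: power_mult_distrib exp_of_nat_mult[symmetric] u(2))
  finally show ?thesis .
qed

(* With variance 4/25, multiplication by exp (2 (x - m)^2) rescales the Gaussian to variance 4/9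
   and costs the factor 5/3; the shift of the centre by at most 1/4 costs exp (1/8) <= 6/5. *)
lemma normal_density_abs_power_le:
  assumes q: "q \<ge> 1" and a: "\<bar>m - a\<bar> \<le> 1 / 4"
  shows "normal_density m (2 / 5) x * \<bar>x - a\<bar> ^ q \<le>
    2 * (sqrt (real q) / 2) ^ q * normal_density m (2 / 3) x"
proof -
  have "exp (1 / 8 :: real) \<le> 1 + 1 / 8 + (1 / 8)\<^sup>2" by (rule exp_bound) auto
  then have e: "exp (1 / 8 :: real) \<le> 6 / 5" by (simp add: power2_eq_square)
  have "(m - a)\<^sup>2 \<le> (1 / 4)\<^sup>2" using a by (metis abs_ge_zero power2_abs power_mono)
  then have m: "2 * (m - a)\<^sup>2 \<le> 1 / 8" by (simp add: power2_eq_square)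
  have "(x - a)\<^sup>2 \<le> 2 * (x - m)\<^sup>2 + 2 * (m - a)\<^sup>2"
    using zero_le_power2[of "(x - m) - (m - a)"] by (simp add: power2_eq_square algebra_simps)
  with m have "(x - a)\<^sup>2 \<le> 2 * (x - m)\<^sup>2 + 1 / 8" by linarith
  then have "exp ((x - a)\<^sup>2) \<le> exp (2 * (x - m)\<^sup>2) * exp (1 / 8)"
    by (simp add: exp_add[symmetric])
  also have "\<dots> \<le> exp (2 * (x - m)\<^sup>2) * (6 / 5)" using e by (intro mult_left_mono) auto
  finally have "normal_density m (2 / 5) x * exp ((x - a)\<^sup>2) \<le>
      normal_density m (2 / 5) x * (exp (2 * (x - m)\<^sup>2) * (6 / 5))"
    by (intro mult_left_mono) auto
  also have "\<dots> = 2 * normal_density m (2 / 3) x"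
  proof -
    define S where "S = sqrt (2 * pi)"
    have S: "S > 0" by (simp add: S_def)
    have sq: "sqrt (2 * pi * (2 / 5)\<^sup>2) = 2 / 5 * S" "sqrt (2 * pi * (2 / 3)\<^sup>2) = 2 / 3 * S"
      by (simp_all add: real_sqrt_mult S_def)
    have ex: "exp (- (x - m)\<^sup>2 / (2 * (2 / 5)\<^sup>2)) * exp (2 * (x - m)\<^sup>2) = exp (- (x - m)\<^sup>2 / (2 * (2 / 3)\<^sup>2))"
      unfolding exp_add[symmetric] by (simp add: power2_eq_square)
    show ?thesis
      unfolding normal_density_def sq ex[symmetric] using S by (simp add: field_simps)
  qed
  finally have *: "normal_density m (2 / 5) x * exp ((x - a)\<^sup>2) \<le> 2 * normal_density m (2 / 3) x" .
  have "normal_density m (2 / 5) x * \<bar>x - a\<bar> ^ q \<le>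
      normal_density m (2 / 5) x * ((sqrt (real q) / 2) ^ q * exp ((x - a)\<^sup>2))"
    by (intro mult_left_mono abs_power_le_exp_square q) auto
  also have "\<dots> = (sqrt (real q) / 2) ^ q * (normal_density m (2 / 5) x * exp ((x - a)\<^sup>2))" by simp
  also have "\<dots> \<le> (sqrt (real q) / 2) ^ q * (2 * normal_density m (2 / 3) x)"
    by (intro mult_left_mono *) simp
  finally show ?thesis by simp
qed

text \<open>For every \<open>K\<close> the centres lie in [0, 1/4], and so does the mean; hence each
  component obeys \<open>normal_density_abs_power_le\<close> around the common point
  \<open>\<mu>\<close>. Averaging bounds the q-th central moment by 2 (sqrt(q) / 2)^q.\<close>

lemma subgaussian_gauss_mix:
  assumes K: "K > 0" and w: "\<And>k. 0 \<le> w k" "(\<Sum>k\<le>K. w k) = 1"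
  shows "subgaussian 1 (gauss_mix w K)"
proof -
  let ?m = "\<lambda>k. real k / (4 * real K)"
  let ?d = "\<lambda>k. normal_density (?m k) (2 / 5)"
  define \<mu> where "\<mu> = (\<Sum>k\<le>K. w k * ?m k)"
  have mean_int: "integrable lborel (\<lambda>x. ?d k x * x)" for k
    by (rule integrable_normal_moment_nz_1) simp
  have "(\<integral>b. b \<partial>gauss_mix w K) = (\<Sum>k\<le>K. w k * (\<integral>x. ?d k x * x \<partial>lborel))"
    by (rule gauss_mix_integral(2)[OF w(1) _ mean_int]) simp
  also have "\<dots> = \<mu>" unfolding \<mu>_def by (simp add: integral_normal_moment_nz_1)
  finally have mean: "(\<integral>b. b \<partial>gauss_mix w K) = \<mu>" .
  have mk: "0 \<le> ?m k" "?m k \<le> 1 / 4" if "k \<le> K" for k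
    using that K by (auto simp: field_simps)
  have "0 \<le> \<mu>" unfolding \<mu>_def using w mk by (intro sum_nonneg mult_nonneg_nonneg) auto
  moreover have "\<mu> \<le> (\<Sum>k\<le>K. w k * (1 / 4))"
    unfolding \<mu>_def using w mk by (intro sum_mono mult_left_mono) auto
  then have "\<mu> \<le> 1 / 4" by (simp add: sum_divide_distrib[symmetric] w)
  ultimately have close: "\<bar>?m k - \<mu>\<bar> \<le> 1 / 4" if "k \<le> K" for k
    using mk[OF that] by linarith
  have "integrable (gauss_mix w K) (\<lambda>b. b)"
    by (rule gauss_mix_integral(1)[OF w(1) _ mean_int]) simp
  moreover have "integrable (gauss_mix w K) (\<lambda>b. \<bar>b - \<mu>\<bar> ^ q) \<and>
      root q (\<integral>b. \<bar>b - \<mu>\<bar> ^ q \<partial>gauss_mix w K) \<le> 1 * sqrt (real q)" if q: "q \<ge> 1" for q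
  proof -
    have dom_int: "integrable lborel (\<lambda>x. 2 * (sqrt (real q) / 2) ^ q * normal_density (?m k) (2 / 3) x)" for k
      by (intro integrable_mult_right integrable_normal_density) simp
    have int: "integrable lborel (\<lambda>x. ?d k x * \<bar>x - \<mu>\<bar> ^ q)" if "k \<le> K" for k
      by (rule Bochner_Integration.integrable_bound[OF dom_int[of k]])
        (auto simp: abs_mult intro!: order_trans[OF normal_density_abs_power_le[OF q close[OF that]]])
    have le: "(\<integral>x. ?d k x * \<bar>x - \<mu>\<bar> ^ q \<partial>lborel) \<le> 2 * (sqrt (real q) / 2) ^ q" if "k \<le> K" for k
    proof -
      have "(\<integral>x. ?d k x * \<bar>x - \<mu>\<bar> ^ q \<partial>lborel) \<le>
          (\<integral>x. 2 * (sqrt (real q) / 2) ^ q * normal_density (?m k) (2 / 3) x \<partial>lborel)"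
        by (intro integral_mono int dom_int normal_density_abs_power_le q close that)
      also have "\<dots> = 2 * (sqrt (real q) / 2) ^ q"
        by simp
      finally show ?thesis .
    qed
    have "(\<integral>b. \<bar>b - \<mu>\<bar> ^ q \<partial>gauss_mix w K) = (\<Sum>k\<le>K. w k * (\<integral>x. ?d k x * \<bar>x - \<mu>\<bar> ^ q \<partial>lborel))"
      by (rule gauss_mix_integral(2)[OF w(1) _ int]) auto
    also have "\<dots> \<le> (\<Sum>k\<le>K. w k * (2 * (sqrt (real q) / 2) ^ q))"
      by (intro sum_mono mult_left_mono le w) auto
    also have "\<dots> = 2 * (sqrt (real q) / 2) ^ q"
      unfolding sum_distrib_right[symmetric] w by simp
    also have "\<dots> = 2 / 2 ^ q * sqrt (real q) ^ q" by (simp add: power_divide)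
    \<comment> \<open>The factor 2 / 2^q is at most 1 because \<open>q\<close> is at least 1, with
      equality at \<open>q = 1\<close>.\<close>
    also have "\<dots> \<le> 1 * sqrt (real q) ^ q"
      using power_increasing[OF q, of "2 :: real"] by (intro mult_right_mono) auto
    finally have "(\<integral>b. \<bar>b - \<mu>\<bar> ^ q \<partial>gauss_mix w K) \<le> sqrt (real q) ^ q" by simp
    then have "root q (\<integral>b. \<bar>b - \<mu>\<bar> ^ q \<partial>gauss_mix w K) \<le> root q (sqrt (real q) ^ q)"
      using q by (intro real_root_le_mono) auto
    also have "\<dots> = sqrt (real q)" using q by (intro real_root_power_cancel) auto
    moreover have "integrable (gauss_mix w K) (\<lambda>b. \<bar>b - \<mu>\<bar> ^ q)"
      by (rule gauss_mix_integral(1)[OF w(1) _ int]) auto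
    ultimately show ?thesis by simp
  qed
  ultimately show ?thesis unfolding subgaussian_def mean by blast
qed

text \<open>For positive \<open>K\<close> the values \<open>s = 1\<close> and \<open>s = - 1\<close>
  give the fair binomial law conditioned on even and on odd outcomes.\<close>

definition parity_weight :: "real \<Rightarrow> nat \<Rightarrow> nat \<Rightarrow> real" where
  "parity_weight s K k = (1 + s * (- 1) ^ k) * real (K choose k) / 2 ^ K"

lemma parity_weight_nonneg: "\<bar>s\<bar> \<le> 1 \<Longrightarrow> 0 \<le> parity_weight s K k"
  unfolding parity_weight_def by (cases "even k") auto

lemma parity_weight_eq: "parity_weight s K k = real (K choose k) / 2 ^ K + s / 2 * alternating_weight K k"
  by (simp add: parity_weight_def alternating_weight_def field_simps)

lemma sum_parity_weight:
  assumes "K > 0"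
  shows "(\<Sum>k\<le>K. parity_weight s K k) = 1"
proof -
  have "(\<Sum>k\<le>K. real (K choose k)) = 2 ^ K"
    using choose_row_sum[of K] by (metis of_nat_sum of_nat_power of_nat_numeral)
  moreover have "(\<Sum>k\<le>K. alternating_weight K k) = 0"
    using sum_alternating_weight_power[of K 1] assms by simp
  ultimately show ?thesis
    by (simp add: parity_weight_eq sum.distrib sum_divide_distrib[symmetric] sum_distrib_left[symmetric])
qed

text \<open>A multiple of the exponential function separates the two laws: its integrals differ by
  the alternating sum at exp(1 / (4 K)), a nonzero multiple of (1 - exp(1 / (4 K)))^K.\<close>

lemma gauss_mix_parity_distinct:
  assumes K: "K > 0"
  shows "gauss_mix (parity_weight 1 K) K \<noteq> gauss_mix (parity_weight (- 1) K) K"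
proof
  assume eq: "gauss_mix (parity_weight 1 K) K = gauss_mix (parity_weight (- 1) K) K"
  let ?m = "\<lambda>k. real k / (4 * real K)"
  \<comment> \<open>With the shift equal to the variance, the tilt is exp(x) normalised to integral
    1 under the centred Gaussian.\<close>
  define f where "f = gauss_tilt (2 / 5) ((2 / 5)\<^sup>2)"
  have [measurable]: "f \<in> borel_measurable borel" unfolding f_def by measurable
  have shift: "f (x + m) = exp m * f x" for x m
    by (simp add: f_def gauss_tilt_def exp_add[symmetric] exp_diff[symmetric] add_divide_distrib distrib_left algebra_simps)
  have val: "(\<integral>\<^sup>+x. ennreal (f x) \<partial>gauss_mix w K) = ennreal (\<Sum>k\<le>K. w k * exp (?m k))"
    if w: "\<And>k. 0 \<le> w k" for w
  proof -
    have "(\<integral>\<^sup>+x. ennreal (f (x + m)) \<partial>gauss (2 / 5)) = ennreal (exp m)" for m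
    proof -
      have "(\<integral>\<^sup>+x. ennreal (f (x + m)) \<partial>gauss (2 / 5)) = (\<integral>\<^sup>+x. ennreal (exp m) * ennreal (f x) \<partial>gauss (2 / 5))"
        unfolding shift by (intro nn_integral_cong ennreal_mult) (auto simp: f_def)
      also have "\<dots> = ennreal (exp m) * (\<integral>\<^sup>+x. ennreal (f x) \<partial>gauss (2 / 5))"
        by (rule nn_integral_cmult) measurable
      also have "\<dots> = ennreal (exp m)" unfolding f_def by (simp add: nn_integral_gauss_tilt)
      finally show ?thesis .
    qed
    then have "(\<integral>\<^sup>+x. ennreal (f x) \<partial>gauss_mix w K) = (\<Sum>k\<le>K. ennreal (w k) * ennreal (exp (?m k)))"
      by (subst nn_integral_gauss_mix[OF w]) auto
    also have "\<dots> = (\<Sum>k\<le>K. ennreal (w k * exp (?m k)))"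
      by (intro sum.cong refl ennreal_mult[symmetric] w) simp
    finally show ?thesis using w by (simp add: sum_ennreal)
  qed
  have "ennreal (\<Sum>k\<le>K. parity_weight 1 K k * exp (?m k)) = ennreal (\<Sum>k\<le>K. parity_weight (- 1) K k * exp (?m k))"
    using val[of "parity_weight 1 K"] val[of "parity_weight (- 1) K"] by (simp add: eq parity_weight_nonneg)
  then have "(\<Sum>k\<le>K. parity_weight 1 K k * exp (?m k)) = (\<Sum>k\<le>K. parity_weight (- 1) K k * exp (?m k))"
    by (subst (asm) ennreal_inj) (auto intro!: sum_nonneg mult_nonneg_nonneg parity_weight_nonneg)
  then have "0 = (\<Sum>k\<le>K. (parity_weight 1 K k - parity_weight (- 1) K k) * exp (?m k))"
    by (simp add: left_diff_distrib sum_subtractf)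
  also have "\<dots> = (\<Sum>k\<le>K. alternating_weight K k * exp (1 / (4 * real K)) ^ k)"
    by (intro sum.cong refl) (simp add: parity_weight_eq exp_of_nat_mult[symmetric])
  also have "\<dots> = 2 / 2 ^ K * (1 - exp (1 / (4 * real K))) ^ K"
    by (rule sum_alternating_weight_power)
  finally show False using K by simp
qed

section \<open>The number of mixture components\<close>

text \<open>The growth condition bounds (n / p)^\<alpha> by p^(-\<delta>\<alpha>), and this decay
  beats the logarithm, so a large enough power also beats the factor \<open>p\<close>. The choice of
  \<open>K\<close> precedes that of \<open>n\<close> and \<open>p\<close>, so the priors do not vary
  with the dimension.\<close>

lemma column_bound_eventually:
  fixes \<delta> \<alpha> C \<gamma> \<tau> :: real
  assumes \<delta>: "\<delta> > 0" and \<alpha>: "\<alpha> > 0" and C: "C \<ge> 0" and \<tau>: "\<tau> > 0"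
  shows "\<exists>K::nat. K > 0 \<and> (\<exists>N::nat. \<forall>n p. p \<ge> N \<longrightarrow> real n \<le> real p powr (1 - \<delta>) \<longrightarrow>
    C * (real n / real p) powr \<alpha> * ln (real p) powr \<gamma> \<le> \<tau> \<and>
    real p * (2 * (C * (real n / real p) powr \<alpha> * ln (real p) powr \<gamma> / \<tau>) ^ K) \<le> 0.1)"
proof -
  \<comment> \<open>One half of the decay rate absorbs \<open>C\<close>, \<open>\<tau>\<close> and
    the logarithm; the other half is raised to the power \<open>K\<close>.\<close>
  define a where "a = \<delta> * \<alpha> / 2"
  have a: "a > 0" using \<delta> \<alpha> by (simp add: a_def)
  \<comment> \<open>This makes a K at least 2, so that p times p^(-a K) is at most 1 / p.\<close>
  define K where "K = nat \<lceil>2 / a\<rceil> + 1"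
  have K: "2 \<le> a * real K"
  proof -
    have "2 / a \<le> real K" unfolding K_def by linarith
    then show ?thesis using a by (simp add: field_simps)
  qed
  have "((\<lambda>x::real. C * x powr (- a) * ln x powr \<gamma>) \<longlongrightarrow> 0) at_top"
    using a by real_asymp
  then have "eventually (\<lambda>x::real. C * x powr (- a) * ln x powr \<gamma> < \<tau>) at_top"
    using \<tau> by (rule order_tendstoD)
  then obtain x0 where x0: "\<And>x. x \<ge> x0 \<Longrightarrow> C * x powr (- a) * ln x powr \<gamma> < \<tau>"
    by (auto simp: eventually_at_top_linorder)
  \<comment> \<open>The final bound is 2 / p, which is at most 0.1 from p = 20 on.\<close>
  define N where "N = max 20 (nat \<lceil>x0\<rceil>)"
  have "C * (real n / real p) powr \<alpha> * ln (real p) powr \<gamma> \<le> \<tau> \<and>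
    real p * (2 * (C * (real n / real p) powr \<alpha> * ln (real p) powr \<gamma> / \<tau>) ^ K) \<le> 0.1"
    if p: "p \<ge> N" and n: "real n \<le> real p powr (1 - \<delta>)" for n p
  proof -
    have p20: "real p \<ge> 20" using p by (simp add: N_def)
    have "nat \<lceil>x0\<rceil> \<le> p" using p by (simp add: N_def)
    then have "real p \<ge> x0" by linarith
    let ?r = "C * (real n / real p) powr \<alpha> * ln (real p) powr \<gamma>"
    have "real n / real p \<le> real p powr (- \<delta>)"
      using n p20 by (simp add: powr_diff powr_minus field_simps)
    then have "(real n / real p) powr \<alpha> \<le> (real p powr (- \<delta>)) powr \<alpha>"
      using \<alpha> by (intro powr_mono2) auto
    also have "\<dots> = real p powr (- a) * real p powr (- a)"
      by (simp add: powr_powr powr_add[symmetric] a_def mult.commute)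
    finally have "?r \<le> C * (real p powr (- a) * real p powr (- a)) * ln (real p) powr \<gamma>"
      using C by (intro mult_right_mono mult_left_mono) auto
    also have "\<dots> = (C * real p powr (- a) * ln (real p) powr \<gamma>) * real p powr (- a)" by simp
    also have "\<dots> \<le> \<tau> * real p powr (- a)"
      using x0[OF \<open>real p \<ge> x0\<close>] by (intro mult_right_mono) auto
    finally have r: "?r \<le> \<tau> * real p powr (- a)" .
    have "real p powr (- a) \<le> real p powr 0" using p20 a by (intro powr_mono) auto
    then have "\<tau> * real p powr (- a) \<le> \<tau>" using p20 \<tau> by simp
    with r have 1: "?r \<le> \<tau>" by linarith
    have "?r \<ge> 0" using C by simp
    then have "(?r / \<tau>) ^ K \<le> (real p powr (- a)) ^ K"
      using r \<tau> by (intro power_mono) (auto simp: field_simps)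
    also have "\<dots> = real p powr (- (a * real K))"
      using p20 by (simp add: powr_realpow[symmetric] powr_powr)
    also have "\<dots> \<le> real p powr (- 2)" using p20 K by (intro powr_mono) auto
    also have "\<dots> = 1 / (real p * real p)" using p20 by (simp add: powr_minus power2_eq_square field_simps)
    finally have "real p * (2 * (?r / \<tau>) ^ K) \<le> real p * (2 * (1 / (real p * real p)))"
      by (intro mult_left_mono) auto
    also have "\<dots> = 2 / real p" using p20 by simp
    also have "\<dots> \<le> 0.1" using p20 by (simp add: field_simps)
    finally show ?thesis using 1 by simp
  qed
  moreover have "K > 0" by (simp add: K_def)
  ultimately show ?thesis by blast
qed

section \<open>Joint translations of coefficients and noise\<close>

definition pair_tilt :: "real \<Rightarrow> real \<Rightarrow> 'i set \<Rightarrow> 'j set \<Rightarrow> ('i \<Rightarrow> real) \<Rightarrow> ('j \<Rightarrow> real) \<Rightarrow> ('i \<Rightarrow> real) \<times> ('j \<Rightarrow> real) \<Rightarrow> real" where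
  "pair_tilt s t I J v e x = (\<Prod>l\<in>I. gauss_tilt s (v l) (fst x l)) * (\<Prod>i\<in>J. gauss_tilt t (e i) (snd x i))"

lemma pair_tilt_nonneg [simp]: "0 \<le> pair_tilt s t I J v e x"
  by (simp add: pair_tilt_def prod_nonneg)

lemma prod_gauss_tilt_measurable:
  "(\<lambda>x. \<Prod>l\<in>I. gauss_tilt s (v l) (x l)) \<in> borel_measurable (\<Pi>\<^sub>M l\<in>I. borel)"
  by (intro borel_measurable_prod measurable_compose[OF _ gauss_tilt_measurable] measurable_component_singleton)

lemma pair_tilt_measurable [measurable]:
  "pair_tilt s t I J v e \<in> borel_measurable ((\<Pi>\<^sub>M l\<in>I. borel) \<Otimes>\<^sub>M (\<Pi>\<^sub>M i\<in>J. borel))"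
  unfolding pair_tilt_def
  by (intro borel_measurable_times measurable_compose[OF measurable_fst prod_gauss_tilt_measurable]
      measurable_compose[OF measurable_snd prod_gauss_tilt_measurable])

lemma sets_PiM_gauss [measurable_cong]: "sets (\<Pi>\<^sub>M l\<in>I. gauss s) = sets (\<Pi>\<^sub>M l\<in>I. borel)"
  by (intro sets_PiM_cong) simp_all

lemma prob_space_PiM_gauss: "s > 0 \<Longrightarrow> prob_space (\<Pi>\<^sub>M l\<in>I. gauss s)"
  by (intro prob_space_PiM prob_space_normal_density)

text \<open>The finite-dimensional formula is applied to the noise and then to the coefficients. The
  left side is an iterated integral to match \<open>shifted_response_prob\<close>.\<close>

lemma nn_integral_pair_gauss_shift:
  assumes s: "s > 0" and t: "t > 0" and fin: "finite I" "finite J"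
    and F [measurable]: "F \<in> borel_measurable ((\<Pi>\<^sub>M l\<in>I. borel) \<Otimes>\<^sub>M (\<Pi>\<^sub>M i\<in>J. borel))"
  shows "(\<integral>\<^sup>+z. \<integral>\<^sup>+y. F (\<lambda>l\<in>I. z l + v l, \<lambda>i\<in>J. y i + e i) \<partial>(\<Pi>\<^sub>M i\<in>J. gauss t) \<partial>(\<Pi>\<^sub>M l\<in>I. gauss s)) =
    (\<integral>\<^sup>+x. F x * ennreal (pair_tilt s t I J v e x) \<partial>((\<Pi>\<^sub>M l\<in>I. gauss s) \<Otimes>\<^sub>M (\<Pi>\<^sub>M i\<in>J. gauss t)))"
proof -
  interpret N: prob_space "\<Pi>\<^sub>M i\<in>J. gauss t" using t by (rule prob_space_PiM_gauss)
  let ?V = "\<lambda>z. \<Prod>l\<in>I. gauss_tilt s (v l) (z l)" and ?U = "\<lambda>y. \<Prod>i\<in>J. gauss_tilt t (e i) (y i)"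
  note [measurable] = prod_gauss_tilt_measurable
  define H where "H z = (\<integral>\<^sup>+y. F (z, y) * ennreal (?U y) \<partial>(\<Pi>\<^sub>M i\<in>J. gauss t))" for z
  have H [measurable]: "H \<in> borel_measurable (\<Pi>\<^sub>M l\<in>I. borel)"
    unfolding H_def by measurable
  have "(\<integral>\<^sup>+z. \<integral>\<^sup>+y. F (\<lambda>l\<in>I. z l + v l, \<lambda>i\<in>J. y i + e i) \<partial>(\<Pi>\<^sub>M i\<in>J. gauss t) \<partial>(\<Pi>\<^sub>M l\<in>I. gauss s)) =
      (\<integral>\<^sup>+z. H (\<lambda>l\<in>I. z l + v l) \<partial>(\<Pi>\<^sub>M l\<in>I. gauss s))"
    unfolding H_def
    by (intro nn_integral_cong nn_integral_PiM_gauss_shift t fin measurable_compose[OF measurable_Pair1' F])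
      (simp add: space_PiM)
  also have "\<dots> = (\<integral>\<^sup>+z. H z * ennreal (?V z) \<partial>(\<Pi>\<^sub>M l\<in>I. gauss s))"
    by (rule nn_integral_PiM_gauss_shift[OF s fin(1) H])
  also have "\<dots> = (\<integral>\<^sup>+z. \<integral>\<^sup>+y. F (z, y) * ennreal (pair_tilt s t I J v e (z, y)) \<partial>(\<Pi>\<^sub>M i\<in>J. gauss t) \<partial>(\<Pi>\<^sub>M l\<in>I. gauss s))"
  proof (rule nn_integral_cong)
    fix z assume "z \<in> space (\<Pi>\<^sub>M l\<in>I. gauss s)"
    then have z: "z \<in> space (\<Pi>\<^sub>M l\<in>I. borel)" by (simp add: space_PiM)
    have [measurable]: "(\<lambda>y. F (z, y)) \<in> borel_measurable (\<Pi>\<^sub>M i\<in>J. borel)"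
      by (rule measurable_compose[OF measurable_Pair1'[OF z] F])
    have "H z * ennreal (?V z) = (\<integral>\<^sup>+y. F (z, y) * ennreal (?U y) * ennreal (?V z) \<partial>(\<Pi>\<^sub>M i\<in>J. gauss t))"
      unfolding H_def by (rule nn_integral_multc[symmetric]) measurable
    also have "\<dots> = (\<integral>\<^sup>+y. F (z, y) * ennreal (pair_tilt s t I J v e (z, y)) \<partial>(\<Pi>\<^sub>M i\<in>J. gauss t))"
      by (intro nn_integral_cong)
        (simp add: pair_tilt_def ennreal_mult[OF prod_nonneg prod_nonneg] mult.assoc mult.commute[of "ennreal (?V z)"])
    finally show "H z * ennreal (?V z) =
      (\<integral>\<^sup>+y. F (z, y) * ennreal (pair_tilt s t I J v e (z, y)) \<partial>(\<Pi>\<^sub>M i\<in>J. gauss t))" .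
  qed
  also have "\<dots> = (\<integral>\<^sup>+x. F x * ennreal (pair_tilt s t I J v e x) \<partial>((\<Pi>\<^sub>M l\<in>I. gauss s) \<Otimes>\<^sub>M (\<Pi>\<^sub>M i\<in>J. gauss t)))"
    by (rule N.nn_integral_fst) measurable
  finally show ?thesis .
qed

lemma gauss_tilt_shift: "gauss_tilt s (b * v) (x + a * v) = gauss_tilt s (b * v) x * exp (a * b * (v\<^sup>2 / s\<^sup>2))"
  unfolding gauss_tilt_def exp_add[symmetric]
  by (simp add: add_divide_distrib distrib_left power2_eq_square mult_ac)

text \<open>A tilt is the exponential of an affine function, so translating along the same direction
  only multiplies it by the exponential of the cross term, a b times the energy.\<close>

lemma pair_tilt_shift:
  assumes "finite I" "finite J"
  shows "pair_tilt s t I J (\<lambda>l. b * v l) (\<lambda>i. b * e i) (\<lambda>l\<in>I. z l + a * v l, \<lambda>i\<in>J. y i + a * e i) =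
    pair_tilt s t I J (\<lambda>l. b * v l) (\<lambda>i. b * e i) (z, y) *
      exp (a * b * ((\<Sum>l\<in>I. (v l)\<^sup>2) / s\<^sup>2 + (\<Sum>i\<in>J. (e i)\<^sup>2) / t\<^sup>2))"
proof -
  have "(\<Prod>l\<in>I. gauss_tilt s (b * v l) ((\<lambda>l\<in>I. z l + a * v l) l)) =
      (\<Prod>l\<in>I. gauss_tilt s (b * v l) (z l)) * exp (a * b * ((\<Sum>l\<in>I. (v l)\<^sup>2) / s\<^sup>2))"
    using assms by (simp add: gauss_tilt_shift prod.distrib exp_sum[symmetric] sum_distrib_left sum_divide_distrib)
  moreover have "(\<Prod>i\<in>J. gauss_tilt t (b * e i) ((\<lambda>i\<in>J. y i + a * e i) i)) =
      (\<Prod>i\<in>J. gauss_tilt t (b * e i) (y i)) * exp (a * b * ((\<Sum>i\<in>J. (e i)\<^sup>2) / t\<^sup>2))"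
    using assms by (simp add: gauss_tilt_shift prod.distrib exp_sum[symmetric] sum_distrib_left sum_divide_distrib)
  ultimately show ?thesis
    unfolding pair_tilt_def fst_conv snd_conv distrib_left exp_add by (simp only: mult_ac)
qed

text \<open>These are the Gram entries of the tilts along one direction: one tilt is absorbed as a
  translation, under which the other gains a constant factor, and a single tilt integrates to
  1.\<close>

lemma nn_integral_pair_tilt_mult:
  fixes v :: "'i \<Rightarrow> real" and e :: "'j \<Rightarrow> real"
  assumes s: "s > 0" and t: "t > 0" and fin: "finite I" "finite J"
  defines "M \<equiv> (\<Pi>\<^sub>M l\<in>I. gauss s) \<Otimes>\<^sub>M (\<Pi>\<^sub>M i\<in>J. gauss t)"
  shows "(\<integral>\<^sup>+x. ennreal (pair_tilt s t I J (\<lambda>l. a * v l) (\<lambda>i. a * e i) x *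
      pair_tilt s t I J (\<lambda>l. b * v l) (\<lambda>i. b * e i) x) \<partial>M) =
    ennreal (exp (a * b * ((\<Sum>l\<in>I. (v l)\<^sup>2) / s\<^sup>2 + (\<Sum>i\<in>J. (e i)\<^sup>2) / t\<^sup>2)))"
proof -
  interpret P: prob_space "\<Pi>\<^sub>M l\<in>I. gauss s" using s by (rule prob_space_PiM_gauss)
  interpret N: prob_space "\<Pi>\<^sub>M i\<in>J. gauss t" using t by (rule prob_space_PiM_gauss)
  let ?W = "\<lambda>b. pair_tilt s t I J (\<lambda>l. b * v l) (\<lambda>i. b * e i)"
  let ?c = "exp (a * b * ((\<Sum>l\<in>I. (v l)\<^sup>2) / s\<^sup>2 + (\<Sum>i\<in>J. (e i)\<^sup>2) / t\<^sup>2))"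
  note shift = nn_integral_pair_gauss_shift[OF s t fin]
  have one: "(\<integral>\<^sup>+x. ennreal (?W b x) \<partial>M) = 1"
    using shift[of "\<lambda>_. 1" "\<lambda>l. b * v l" "\<lambda>i. b * e i"] P.emeasure_space_1 N.emeasure_space_1
    by (simp add: M_def)
  have "(\<integral>\<^sup>+x. ennreal (?W a x * ?W b x) \<partial>M) = (\<integral>\<^sup>+x. ennreal (?W b x) * ennreal (?W a x) \<partial>M)"
    by (intro nn_integral_cong) (simp add: ennreal_mult mult.commute)
  also have "\<dots> = (\<integral>\<^sup>+z. \<integral>\<^sup>+y. ennreal (?W b (\<lambda>l\<in>I. z l + a * v l, \<lambda>i\<in>J. y i + a * e i))
      \<partial>(\<Pi>\<^sub>M i\<in>J. gauss t) \<partial>(\<Pi>\<^sub>M l\<in>I. gauss s))"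
    unfolding M_def by (rule shift[symmetric]) measurable
  also have "\<dots> = (\<integral>\<^sup>+z. \<integral>\<^sup>+y. ennreal (?W b (z, y)) * ennreal ?c
      \<partial>(\<Pi>\<^sub>M i\<in>J. gauss t) \<partial>(\<Pi>\<^sub>M l\<in>I. gauss s))"
    unfolding pair_tilt_shift[OF fin] by (intro nn_integral_cong ennreal_mult) auto
  also have "\<dots> = (\<integral>\<^sup>+x. ennreal (?W b x) * ennreal ?c \<partial>M)"
    unfolding M_def by (rule N.nn_integral_fst) measurable
  also have "\<dots> = (\<integral>\<^sup>+x. ennreal (?W b x) \<partial>M) * ennreal ?c"
    unfolding M_def by (rule nn_integral_multc) measurable
  finally show ?thesis unfolding one by simp
qed

section \<open>Response probabilities given the mixture labels\<close>

definition linear_response :: "real mat \<Rightarrow> (nat \<Rightarrow> real) \<times> (nat \<Rightarrow> real) \<Rightarrow> nat \<Rightarrow> real" where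
  "linear_response X x = (\<lambda>i\<in>{..<dim_row X}. (\<Sum>j<dim_col X. X $$ (i, j) * fst x j) + snd x i)"

lemma linear_response_measurable [measurable]:
  "linear_response X \<in> ((\<Pi>\<^sub>M j\<in>{..<dim_col X}. borel) \<Otimes>\<^sub>M (\<Pi>\<^sub>M i\<in>{..<dim_row X}. borel))
    \<rightarrow>\<^sub>M (\<Pi>\<^sub>M i\<in>{..<dim_row X}. borel)"
  unfolding linear_response_def by measurable

text \<open>The conditional probability of the event \<open>A\<close> when the Gaussian coefficients
  are centred at \<open>u\<close>. It is real because it will be summed with signed weights.\<close>

definition shifted_response_prob :: "real mat \<Rightarrow> real \<Rightarrow> (nat \<Rightarrow> real) set \<Rightarrow> (nat \<Rightarrow> real) \<Rightarrow> real" where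
  "shifted_response_prob X \<sigma> A u =
    enn2real (\<integral>\<^sup>+z. \<integral>\<^sup>+y. indicator A (linear_response X (\<lambda>j\<in>{..<dim_col X}. z j + u j, y))
      \<partial>(\<Pi>\<^sub>M i\<in>{..<dim_row X}. gauss \<sigma>) \<partial>(\<Pi>\<^sub>M j\<in>{..<dim_col X}. gauss (2 / 5)))"

text \<open>The integral is at most 1, so the default value 0 of \<open>enn2real\<close> at infinity
  does not occur.\<close>

lemma ennreal_shifted_response_prob:
  assumes \<sigma>: "\<sigma> > 0"
  shows "ennreal (shifted_response_prob X \<sigma> A u) =
    (\<integral>\<^sup>+z. \<integral>\<^sup>+y. indicator A (linear_response X (\<lambda>j\<in>{..<dim_col X}. z j + u j, y))
      \<partial>(\<Pi>\<^sub>M i\<in>{..<dim_row X}. gauss \<sigma>) \<partial>(\<Pi>\<^sub>M j\<in>{..<dim_col X}. gauss (2 / 5)))"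
    (is "_ = ?R")
proof -
  interpret P: prob_space "\<Pi>\<^sub>M j\<in>{..<dim_col X}. gauss (2 / 5)" by (rule prob_space_PiM_gauss) simp
  interpret N: prob_space "\<Pi>\<^sub>M i\<in>{..<dim_row X}. gauss \<sigma>" using \<sigma> by (rule prob_space_PiM_gauss)
  have "?R \<le> (\<integral>\<^sup>+z. \<integral>\<^sup>+y. 1 \<partial>(\<Pi>\<^sub>M i\<in>{..<dim_row X}. gauss \<sigma>) \<partial>(\<Pi>\<^sub>M j\<in>{..<dim_col X}. gauss (2 / 5)))"
    by (intro nn_integral_mono) (simp add: indicator_def)
  also have "\<dots> = 1" by (simp add: P.emeasure_space_1 N.emeasure_space_1)
  finally have "?R < \<top>" by (rule le_less_trans) simp
  then show ?thesis unfolding shifted_response_prob_def by (rule ennreal_enn2real)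
qed

text \<open>Integrating out the noise leaves the function \<open>\<Phi>\<close> of the coefficients,
  to which the expansion over labels applies.\<close>

lemma measure_response_law_gauss_mix:
  assumes \<sigma>: "\<sigma> > 0" and w: "\<And>k. 0 \<le> w k" "(\<Sum>k\<le>K. w k) = 1"
    and A: "A \<in> sets (\<Pi>\<^sub>M i\<in>{..<dim_row X}. borel)"
  shows "measure (response_law (gauss_mix w K) X \<sigma>) A =
    (\<Sum>b\<in>{..<dim_col X} \<rightarrow>\<^sub>E {..K}. (\<Prod>j<dim_col X. w (b j)) *
      shifted_response_prob X \<sigma> A (\<lambda>j. real (b j) / (4 * real K)))"
proof -
  let ?G = "gauss_mix w K" and ?I = "{..<dim_col X}" and ?J = "{..<dim_row X}"
  interpret G: real_distribution ?G by (rule real_distribution_gauss_mix[OF w])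
  interpret PN: prob_space "gauss (2 / 5)" by (rule prob_space_normal_density) simp
  interpret N: prob_space "\<Pi>\<^sub>M i\<in>?J. gauss \<sigma>" using \<sigma> by (rule prob_space_PiM_gauss)
  note [measurable] = A
  have [measurable_cong]: "sets (\<Pi>\<^sub>M j\<in>?I. ?G) = sets (\<Pi>\<^sub>M j\<in>?I. borel)"
    by (intro sets_PiM_cong) simp_all
  define \<Phi> where "\<Phi> \<beta> = (\<integral>\<^sup>+y. indicator A (linear_response X (\<beta>, y)) \<partial>(\<Pi>\<^sub>M i\<in>?J. gauss \<sigma>))" for \<beta>
  have \<Phi> [measurable]: "\<Phi> \<in> borel_measurable (\<Pi>\<^sub>M j\<in>?I. borel)"
    unfolding \<Phi>_def by measurable
  have law: "response_law ?G X \<sigma> = distr ((\<Pi>\<^sub>M j\<in>?I. ?G) \<Otimes>\<^sub>M (\<Pi>\<^sub>M i\<in>?J. gauss \<sigma>)) (\<Pi>\<^sub>M i\<in>?J. borel) (linear_response X)"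
    unfolding response_law_def linear_response_def by (simp add: case_prod_unfold)
  have "emeasure (response_law ?G X \<sigma>) A = (\<integral>\<^sup>+x. indicator A x \<partial>response_law ?G X \<sigma>)"
    by (simp add: law)
  also have "\<dots> = (\<integral>\<^sup>+x. indicator A (linear_response X x) \<partial>((\<Pi>\<^sub>M j\<in>?I. ?G) \<Otimes>\<^sub>M (\<Pi>\<^sub>M i\<in>?J. gauss \<sigma>)))"
    unfolding law by (rule nn_integral_distr) measurable
  also have "\<dots> = (\<integral>\<^sup>+\<beta>. \<Phi> \<beta> \<partial>(\<Pi>\<^sub>M j\<in>?I. ?G))"
    unfolding \<Phi>_def by (rule N.nn_integral_fst[symmetric]) measurable
  also have "\<dots> = (\<Sum>b\<in>?I \<rightarrow>\<^sub>E {..K}. (\<Prod>j\<in>?I. ennreal (w (b j))) *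
      (\<integral>\<^sup>+z. \<Phi> (\<lambda>j\<in>?I. z j + real (b j) / (4 * real K)) \<partial>(\<Pi>\<^sub>M j\<in>?I. gauss (2 / 5))))"
    by (rule nn_integral_PiM_mixture[where m = "\<lambda>k. real k / (4 * real K)"])
      (auto intro: nn_integral_gauss_mix[OF w(1)] G.prob_space_axioms PN.prob_space_axioms)
  also have "\<dots> = (\<Sum>b\<in>?I \<rightarrow>\<^sub>E {..K}. ennreal ((\<Prod>j\<in>?I. w (b j)) *
      shifted_response_prob X \<sigma> A (\<lambda>j. real (b j) / (4 * real K))))"
  proof (intro sum.cong refl)
    fix b
    have "(\<Prod>j\<in>?I. ennreal (w (b j))) = ennreal (\<Prod>j\<in>?I. w (b j))"
      by (rule prod_ennreal) (rule w)
    then show "(\<Prod>j\<in>?I. ennreal (w (b j))) *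
        (\<integral>\<^sup>+z. \<Phi> (\<lambda>j\<in>?I. z j + real (b j) / (4 * real K)) \<partial>(\<Pi>\<^sub>M j\<in>?I. gauss (2 / 5))) =
      ennreal ((\<Prod>j\<in>?I. w (b j)) * shifted_response_prob X \<sigma> A (\<lambda>j. real (b j) / (4 * real K)))"
      unfolding \<Phi>_def ennreal_shifted_response_prob[OF \<sigma>, symmetric]
      by (simp add: ennreal_mult prod_nonneg w shifted_response_prob_def)
  qed
  also have "\<dots> = ennreal (\<Sum>b\<in>?I \<rightarrow>\<^sub>E {..K}. (\<Prod>j\<in>?I. w (b j)) *
      shifted_response_prob X \<sigma> A (\<lambda>j. real (b j) / (4 * real K)))"
    by (intro sum_ennreal mult_nonneg_nonneg prod_nonneg) (auto simp: w shifted_response_prob_def)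
  finally show ?thesis
    unfolding measure_def
    by (simp add: sum_nonneg prod_nonneg w shifted_response_prob_def)
qed

text \<open>Moving the centre of coordinate \<open>j\<close> from 0 to \<open>c\<close> adds
  \<open>c\<close> times column \<open>j\<close> to the response, and by the splitting of that
  column the same change results from translating the coefficients by c v and the noise by c
  e.\<close>

lemma linear_response_shift:
  assumes X: "X \<in> carrier_mat n p" and j: "j < p"
    and v: "\<And>i. i < n \<Longrightarrow> (\<Sum>l<p. X $$ (i, l) * v l) + e i = X $$ (i, j)"
  shows "linear_response X (\<lambda>l\<in>{..<p}. z l + (u(j := c)) l, y) =
    linear_response X (\<lambda>l\<in>{..<p}. (\<lambda>l\<in>{..<p}. z l + c * v l) l + (u(j := 0)) l, \<lambda>i\<in>{..<n}. y i + c * e i)"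
proof
  fix i
  show "linear_response X (\<lambda>l\<in>{..<p}. z l + (u(j := c)) l, y) i =
    linear_response X (\<lambda>l\<in>{..<p}. (\<lambda>l\<in>{..<p}. z l + c * v l) l + (u(j := 0)) l, \<lambda>i\<in>{..<n}. y i + c * e i) i"
  proof (cases "i < n")
    case True
    have "(\<Sum>l<p. X $$ (i, l) * (z l + (u(j := c)) l)) =
        (\<Sum>l<p. X $$ (i, l) * (z l + (u(j := 0)) l) + (if l = j then c * X $$ (i, j) else 0))"
      by (intro sum.cong) (auto simp: algebra_simps)
    also have "\<dots> = (\<Sum>l<p. X $$ (i, l) * (z l + (u(j := 0)) l)) + c * X $$ (i, j)"
      using j by (simp add: sum.distrib)
    also have "c * X $$ (i, j) = (\<Sum>l<p. X $$ (i, l) * (c * v l)) + c * e i"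
      unfolding v[OF True, symmetric] by (simp add: distrib_left sum_distrib_left mult_ac)
    finally have "(\<Sum>l<p. X $$ (i, l) * (z l + (u(j := c)) l)) =
        (\<Sum>l<p. X $$ (i, l) * (z l + c * v l + (u(j := 0)) l)) + c * e i"
      by (simp add: distrib_left sum.distrib)
    then show ?thesis using X True by (simp add: linear_response_def del: fun_upd_apply)
  qed (use X in \<open>simp add: linear_response_def\<close>)
qed

section \<open>From one coordinate to the total variation distance\<close>

text \<open>All labels of coordinate \<open>j\<close> translate the same Gaussian along one
  direction, so the alternating sum is the integral of a signed mixture of tilts over a fixed event.
  Its second moment is the alternating quadratic form.\<close>

lemma alternating_coordinate_bound:
  assumes X: "X \<in> carrier_mat n p" and \<sigma>: "\<sigma> > 0" and j: "j < p" and K: "K > 0"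
    and A: "A \<in> sets (\<Pi>\<^sub>M i\<in>{..<n}. borel)"
    and r: "euclidean_norm_vec (whitened_design X \<sigma> *\<^sub>v unit_vec p j) / (2 / 5) \<le> r" "r \<le> 1"
  shows "\<bar>\<Sum>k\<le>K. alternating_weight K k *
      shifted_response_prob X \<sigma> A (u(j := real k / (4 * real K)))\<bar> \<le> 2 * r ^ K"
proof -
  let ?I = "{..<p}" and ?J = "{..<n}" and ?\<nu> = "euclidean_norm_vec (whitened_design X \<sigma> *\<^sub>v unit_vec p j)"
  let ?c = "\<lambda>k. real k / (4 * real K)"
  obtain v e where v: "\<And>i. i < n \<Longrightarrow> (\<Sum>l<p. X $$ (i, l) * v l) + e i = X $$ (i, j)"
    and norm: "(\<Sum>l<p. (v l)\<^sup>2) + (\<Sum>i<n. (e i)\<^sup>2) / \<sigma>\<^sup>2 = ?\<nu>\<^sup>2"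
    using whitened_column_representation[OF X \<sigma> j] by blast
  \<comment> \<open>The energy of the direction relative to the prior variance (2/5)^2 and the noise
    variance.\<close>
  define \<rho> where "\<rho> = (\<Sum>l\<in>?I. (v l)\<^sup>2) / (2 / 5)\<^sup>2 + (\<Sum>i\<in>?J. (e i)\<^sup>2) / \<sigma>\<^sup>2"
  have \<nu>: "0 \<le> ?\<nu>" by (simp add: euclidean_norm_vec_def scalar_prod_self_eq sum_nonneg)
  then have r0: "0 \<le> r" using r(1) by (auto intro: order_trans[rotated])
  have \<rho>0: "0 \<le> \<rho>" unfolding \<rho>_def by (intro add_nonneg_nonneg divide_nonneg_nonneg sum_nonneg) auto
  have "0 \<le> (\<Sum>i\<in>?J. (e i)\<^sup>2) / \<sigma>\<^sup>2" by (intro divide_nonneg_nonneg sum_nonneg) auto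
  \<comment> \<open>Since 2/5 is below 1, dividing the noise part by (2/5)^2 as well can only
    enlarge it.\<close>
  then have "\<rho> \<le> ?\<nu>\<^sup>2 / (2 / 5)\<^sup>2"
    unfolding \<rho>_def norm[symmetric] by (simp add: power2_eq_square field_simps)
  also have "\<dots> = (?\<nu> / (2 / 5))\<^sup>2" by (simp add: power_divide)
  also have "\<dots> \<le> r\<^sup>2" using r(1) \<nu> by (intro power_mono) auto
  finally have \<rho>r: "\<rho> \<le> r\<^sup>2" .
  let ?P = "\<Pi>\<^sub>M l\<in>?I. gauss (2 / 5)" and ?N = "\<Pi>\<^sub>M i\<in>?J. gauss \<sigma>"
  interpret P: prob_space ?P by (rule prob_space_PiM_gauss) simp
  interpret N: prob_space ?N using \<sigma> by (rule prob_space_PiM_gauss)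
  interpret PN: pair_prob_space ?P ?N ..
  \<comment> \<open>The centre of coordinate \<open>j\<close> is set to 0, so the event is the same
    for all \<open>k\<close> and the label enters only through \<open>W k\<close>.\<close>
  define B where "B = {x \<in> space (?P \<Otimes>\<^sub>M ?N). linear_response X (\<lambda>l\<in>?I. fst x l + (u(j := 0)) l, snd x) \<in> A}"
  have dims: "dim_row X = n" "dim_col X = p" using X by auto
  have [measurable]: "linear_response X \<in> ((\<Pi>\<^sub>M j\<in>?I. borel) \<Otimes>\<^sub>M (\<Pi>\<^sub>M i\<in>?J. borel)) \<rightarrow>\<^sub>M (\<Pi>\<^sub>M i\<in>?J. borel)"
    using linear_response_measurable[of X] by (simp add: dims)
  note [measurable] = A
  have B [measurable]: "B \<in> sets (?P \<Otimes>\<^sub>M ?N)" unfolding B_def by measurable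
  have spaces: "space (?P \<Otimes>\<^sub>M ?N) = (?I \<rightarrow>\<^sub>E UNIV) \<times> (?J \<rightarrow>\<^sub>E UNIV)"
    by (simp add: space_pair_measure space_PiM)
  define W where "W k = pair_tilt (2 / 5) \<sigma> ?I ?J (\<lambda>l. ?c k * v l) (\<lambda>i. ?c k * e i)" for k
  have W [measurable]: "W k \<in> borel_measurable (?P \<Otimes>\<^sub>M ?N)" for k unfolding W_def by measurable
  have prob: "shifted_response_prob X \<sigma> A (u(j := ?c k)) = (\<integral>x. indicator B x * W k x \<partial>(?P \<Otimes>\<^sub>M ?N))" for k
  proof -
    have "ennreal (shifted_response_prob X \<sigma> A (u(j := ?c k))) =
       (\<integral>\<^sup>+z. \<integral>\<^sup>+y. indicator A (linear_response X (\<lambda>l\<in>?I. z l + (u(j := ?c k)) l, y)) \<partial>?N \<partial>?P)"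
      unfolding ennreal_shifted_response_prob[OF \<sigma>] dims ..
    also have "\<dots> = (\<integral>\<^sup>+z. \<integral>\<^sup>+y. indicator B (\<lambda>l\<in>?I. z l + ?c k * v l, \<lambda>i\<in>?J. y i + ?c k * e i) \<partial>?N \<partial>?P)"
    proof (intro nn_integral_cong)
      fix z y
      have "linear_response X (\<lambda>l\<in>?I. z l + (u(j := ?c k)) l, y) \<in> A \<longleftrightarrow>
          (\<lambda>l\<in>?I. z l + ?c k * v l, \<lambda>i\<in>?J. y i + ?c k * e i) \<in> B"
        using linear_response_shift[OF X j v, of z u "?c k" y] by (simp add: B_def spaces)
      then show "indicator A (linear_response X (\<lambda>l\<in>?I. z l + (u(j := ?c k)) l, y)) =
          (indicator B (\<lambda>l\<in>?I. z l + ?c k * v l, \<lambda>i\<in>?J. y i + ?c k * e i) :: ennreal)"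
        by (simp only: indicator_def)
    qed
    also have "\<dots> = (\<integral>\<^sup>+x. indicator B x * ennreal (W k x) \<partial>(?P \<Otimes>\<^sub>M ?N))"
      unfolding W_def by (rule nn_integral_pair_gauss_shift) (use \<sigma> in auto)
    also have "\<dots> = (\<integral>\<^sup>+x. ennreal (indicator B x * W k x) \<partial>(?P \<Otimes>\<^sub>M ?N))"
      by (intro nn_integral_cong) (simp add: ennreal_mult' ennreal_indicator W_def)
    finally have eq: "ennreal (shifted_response_prob X \<sigma> A (u(j := ?c k))) = \<dots>" .
    have "shifted_response_prob X \<sigma> A (u(j := ?c k)) = enn2real (ennreal (shifted_response_prob X \<sigma> A (u(j := ?c k))))"
      by (simp add: shifted_response_prob_def)
    also have "\<dots> = (\<integral>x. indicator B x * W k x \<partial>(?P \<Otimes>\<^sub>M ?N))"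
      unfolding eq by (rule integral_eq_nn_integral[symmetric]) (simp_all add: W_def)
    finally show ?thesis .
  qed
  define E where "E k l = exp (\<rho> / (16 * (real K)\<^sup>2) * real k * real l)" for k l
  have E: "(\<integral>\<^sup>+x. ennreal (W k x * W l x) \<partial>(?P \<Otimes>\<^sub>M ?N)) = ennreal (E k l)" for k l
  proof -
    have "(\<integral>\<^sup>+x. ennreal (W k x * W l x) \<partial>(?P \<Otimes>\<^sub>M ?N)) = ennreal (exp (?c k * ?c l * \<rho>))"
      unfolding W_def \<rho>_def by (rule nn_integral_pair_tilt_mult) (use \<sigma> in auto)
    also have "?c k * ?c l * \<rho> = \<rho> / (16 * (real K)\<^sup>2) * real k * real l"
      by (simp add: power2_eq_square)
    finally show ?thesis by (simp add: E_def)
  qed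
  have "\<bar>\<Sum>k\<le>K. alternating_weight K k * shifted_response_prob X \<sigma> A (u(j := ?c k))\<bar> \<le>
      sqrt (\<Sum>k\<le>K. \<Sum>l\<le>K. alternating_weight K k * alternating_weight K l * E k l)"
    unfolding prob
    by (rule PN.weighted_event_bound[OF W _ _ E B]) (simp_all add: W_def E_def)
  also have "\<dots> \<le> sqrt ((2 * r ^ K)\<^sup>2)"
  proof -
    \<comment> \<open>The product of two centres k / (4 K) and l / (4 K) puts s = \<rho> / (16 K^2)
      in the quadratic form, and s K is at most \<rho>.\<close>
    have "\<rho> / (16 * (real K)\<^sup>2) * real K = \<rho> * (1 / (16 * real K))"
      using K by (simp add: power2_eq_square)
    also have "\<dots> \<le> \<rho> * 1" using \<rho>0 K by (intro mult_left_mono) auto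
    also have "\<dots> \<le> r\<^sup>2" using \<rho>r by simp
    finally have "\<rho> / (16 * (real K)\<^sup>2) * real K \<le> r\<^sup>2" .
    then show ?thesis
      unfolding E_def using \<rho>0 r r0
      by (intro real_sqrt_le_mono alternating_weight_quadratic_form) auto
  qed
  also have "\<dots> = 2 * r ^ K" using r0 by (intro real_sqrt_unique) auto
  finally show ?thesis .
qed

text \<open>For each event both probabilities are averages of the same function \<open>Q\<close> of
  the labels, under product weights whose factors differ by \<open>alternating_weight\<close>.
  Exchanging the \<open>p\<close> coordinates in turn costs at most 2 r^K each.\<close>

lemma total_variation_parity_mixtures:
  assumes X: "X \<in> carrier_mat n p" and \<sigma>: "\<sigma> > 0" and K: "K > 0"
    and r: "\<And>j. j < p \<Longrightarrow> euclidean_norm_vec (whitened_design X \<sigma> *\<^sub>v unit_vec p j) / (2 / 5) \<le> r"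
    and r1: "r \<le> 1"
  shows "total_variation (response_law (gauss_mix (parity_weight 1 K) K) X \<sigma>)
    (response_law (gauss_mix (parity_weight (- 1) K) K) X \<sigma>) \<le> real p * (2 * r ^ K)"
  unfolding total_variation_def
proof (rule cSUP_least)
  let ?w = "\<lambda>s. parity_weight s K"
  show "sets (response_law (gauss_mix (?w 1) K) X \<sigma>) \<noteq> {}" by auto
  fix A assume "A \<in> sets (response_law (gauss_mix (?w 1) K) X \<sigma>)"
  then have A: "A \<in> sets (\<Pi>\<^sub>M i\<in>{..<dim_row X}. borel)" by (simp add: response_law_def)
  have dims: "dim_row X = n" "dim_col X = p" using X by auto
  define Q where "Q b = shifted_response_prob X \<sigma> A (\<lambda>j. real (b j) / (4 * real K))" for b
  have Q_upd: "Q (b(j := k)) = shifted_response_prob X \<sigma> A ((\<lambda>j. real (b j) / (4 * real K))(j := real k / (4 * real K)))" for b j k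
    unfolding Q_def by (rule arg_cong[of _ _ "shifted_response_prob X \<sigma> A"]) auto
  have law: "measure (response_law (gauss_mix (?w s) K) X \<sigma>) A =
      (\<Sum>b\<in>{..<p} \<rightarrow>\<^sub>E {..K}. (\<Prod>j<p. ?w s (b j)) * Q b)" if "\<bar>s\<bar> \<le> 1" for s
    using measure_response_law_gauss_mix[OF \<sigma> parity_weight_nonneg[OF that] sum_parity_weight[OF K] A]
    by (simp add: dims Q_def)
  have "\<bar>(\<Sum>b\<in>{..<p} \<rightarrow>\<^sub>E {..K}. (\<Prod>j<p. ?w 1 (b j)) * Q b) - (\<Sum>b\<in>{..<p} \<rightarrow>\<^sub>E {..K}. (\<Prod>j<p. ?w (- 1) (b j)) * Q b)\<bar>
      \<le> real (card {..<p}) * (2 * r ^ K)"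
  proof (rule product_weights_replacement)
    fix b :: "nat \<Rightarrow> nat" and j assume "j \<in> {..<p}"
    then have "\<bar>\<Sum>k\<le>K. alternating_weight K k * Q (b(j := k))\<bar> \<le> 2 * r ^ K"
      unfolding Q_upd using A by (intro alternating_coordinate_bound[OF X \<sigma> _ K _ r r1]) (auto simp: dims)
    then show "\<bar>\<Sum>k\<le>K. (?w 1 k - ?w (- 1) k) * Q (b(j := k))\<bar> \<le> 2 * r ^ K"
      by (simp add: parity_weight_eq)
  qed (auto simp: parity_weight_nonneg sum_parity_weight[OF K])
  then show "\<bar>measure (response_law (gauss_mix (?w 1) K) X \<sigma>) A -
      measure (response_law (gauss_mix (?w (- 1)) K) X \<sigma>) A\<bar> \<le> real p * (2 * r ^ K)"
    by (simp add: law)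
qed

theorem theorem6:
  fixes \<delta> \<alpha> C\<^sub>0 \<gamma> :: real
  assumes "\<delta> > 0" and "\<alpha> > 0" and "C\<^sub>0 \<ge> 0" and "\<gamma> \<ge> 0"
  shows "\<exists>g g' :: real measure.
    real_distribution g \<and> real_distribution g' \<and> g \<noteq> g' \<and>
    subgaussian 1 g \<and> subgaussian 1 g' \<and>
    (\<exists>N::nat. \<forall>n\<ge>N. \<forall>p\<ge>N. real n \<le> real p powr (1 - \<delta>) \<longrightarrow>
      (\<forall>X \<in> carrier_mat n p. \<forall>\<sigma>>0.
        (MAX j\<in>{..<p}. euclidean_norm_vec (whitened_design X \<sigma> *\<^sub>v unit_vec p j))
          \<le> C\<^sub>0 * (real n / real p) powr \<alpha> * ln (real p) powr \<gamma> \<longrightarrow>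
        total_variation (response_law g X \<sigma>) (response_law g' X \<sigma>) \<le> 0.1))"
proof -
  \<comment> \<open>The threshold is the prior standard deviation 2/5, so that the normalised column
    bound is at most 1.\<close>
  obtain K N :: nat where K: "K > 0"
    and N: "\<And>n p. p \<ge> N \<Longrightarrow> real n \<le> real p powr (1 - \<delta>) \<Longrightarrow>
      C\<^sub>0 * (real n / real p) powr \<alpha> * ln (real p) powr \<gamma> \<le> 2 / 5 \<and>
      real p * (2 * (C\<^sub>0 * (real n / real p) powr \<alpha> * ln (real p) powr \<gamma> / (2 / 5)) ^ K) \<le> 0.1"
    using column_bound_eventually[OF assms(1-3), of "2 / 5" \<gamma>] by auto
  let ?g = "\<lambda>s. gauss_mix (parity_weight s K) K"
  have w: "0 \<le> parity_weight 1 K k" "0 \<le> parity_weight (- 1) K k" for k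
    by (simp_all add: parity_weight_nonneg)
  have "total_variation (response_law (?g 1) X \<sigma>) (response_law (?g (- 1)) X \<sigma>) \<le> 0.1"
    if p: "p \<ge> N" and n: "real n \<le> real p powr (1 - \<delta>)" and X: "X \<in> carrier_mat n p" and \<sigma>: "\<sigma> > 0"
      and M: "(MAX j\<in>{..<p}. euclidean_norm_vec (whitened_design X \<sigma> *\<^sub>v unit_vec p j))
          \<le> C\<^sub>0 * (real n / real p) powr \<alpha> * ln (real p) powr \<gamma>" for n p X \<sigma>
  proof -
    let ?R = "C\<^sub>0 * (real n / real p) powr \<alpha> * ln (real p) powr \<gamma>"
    have "euclidean_norm_vec (whitened_design X \<sigma> *\<^sub>v unit_vec p j) \<le> ?R" if "j < p" for j
      by (rule order_trans[OF Max_ge M]) (use that in auto)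
    then have "euclidean_norm_vec (whitened_design X \<sigma> *\<^sub>v unit_vec p j) / (2 / 5) \<le> ?R / (2 / 5)" if "j < p" for j
      using that by (intro divide_right_mono) auto
    moreover have "?R / (2 / 5) \<le> 1" using N[OF p n] by simp
    ultimately have "total_variation (response_law (?g 1) X \<sigma>) (response_law (?g (- 1)) X \<sigma>) \<le>
        real p * (2 * (?R / (2 / 5)) ^ K)"
      by (rule total_variation_parity_mixtures[OF X \<sigma> K])
    also have "\<dots> \<le> 0.1" using N[OF p n] by blast
    finally show ?thesis .
  qed
  then show ?thesis
    using real_distribution_gauss_mix[OF w(1) sum_parity_weight[OF K]]
      real_distribution_gauss_mix[OF w(2) sum_parity_weight[OF K]]
      subgaussian_gauss_mix[OF K w(1) sum_parity_weight[OF K]]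
      subgaussian_gauss_mix[OF K w(2) sum_parity_weight[OF K]]
      gauss_mix_parity_distinct[OF K]
    by (intro exI[of _ "?g 1"] exI[of _ "?g (- 1)"] conjI exI[of _ N]) blast+
qed
end
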